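(* Let $k\geq 1$ be an integer, let $p$ be an odd prime, let $\ell\geq 1$, and let $E\subset(\mathbb{Z}/p^\ell\mathbb{Z})^2$ satisfy $|E|\gtrsim \ell^{\frac{2}{k+1}}p^{\ell s}$, where $s=2-\frac{1}{\ell(k+1)}$. Then $|\mathcal{C}_{k+1}(E)|\gtrsim |\mathcal{C}_{k+1}((\mathbb{Z}/p^\ell\mathbb{Z})^2)|$.
   Context: For a commutative ring $R$ and $x=(x_1,x_2),y=(y_1,y_2)\in R^2$, write $y^\perp=(y_2,-y_1)$, so $x\cdot y^\perp=x_1y_2-x_2y_1$. A $(k+1)$-point configuration is an element $x=(x^1,\dots,x^{k+1})\in (R^2)^{k+1}$. For $E\subset R^2$, define an equivalence relation $\sim$ on $E^{k+1}$ by $x\sim y$ iff $x^i\cdot x^{j\perp}=y^i\cdot y^{j\perp}$ for every pair of indices $i,j$; $\mathcal{C}_{k+1}(E)$ denotes the set of equivalence classes of $E^{k+1}$ under $\sim$. The notation $X\lesssim Y$ (equivalently $Y\gtrsim X$) means $X\leq CY$ for a constant $C$ independent of $p,\ell$ and $E$ (it may depend on $k$); the hypothesis on $|E|$ means $|E|\geq C\ell^{\frac{2}{k+1}}p^{\ell s}$ for a sufficiently large such constant. *)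

theory Defs
  imports Complex_Main "HOL-Computational_Algebra.Primes"
begin

text \<open>The ring Z/qZ is represented by the integers {0..<q}, with arithmetic mod q.
  Points of (Z/qZ)^2 are pairs of such integers.\<close>

definition ZmodSq :: "int \<Rightarrow> (int \<times> int) set" where
  "ZmodSq q = {0..<q} \<times> {0..<q}"

definition dot_perp :: "int \<Rightarrow> int \<times> int \<Rightarrow> int \<times> int \<Rightarrow> int" where
  "dot_perp q x y = (fst x * snd y - snd x * fst y) mod q"

definition configs :: "(int \<times> int) set \<Rightarrow> nat \<Rightarrow> (int \<times> int) list set" where
  "configs E k = {xs. length xs = k + 1 \<and> set xs \<subseteq> E}"

definition config_rel :: "int \<Rightarrow> (int \<times> int) set \<Rightarrow> nat \<Rightarrow> ((int \<times> int) list \<times> (int \<times> int) list) set" where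
  "config_rel q E k = {(xs, ys). xs \<in> configs E k \<and> ys \<in> configs E k \<and>
     (\<forall>i\<le>k. \<forall>j\<le>k. dot_perp q (xs ! i) (xs ! j) = dot_perp q (ys ! i) (ys ! j))}"

definition Cconf :: "int \<Rightarrow> (int \<times> int) set \<Rightarrow> nat \<Rightarrow> (int \<times> int) list set set" where
  "Cconf q E k = configs E k // config_rel q E k"

end

theory Submission
  imports Defs "HOL-Library.FuncSet" "HOL-Analysis.Convex"
begin

text \<open>
  Put \<open>q = p\<^sup>l\<close>. If some determinant of a configuration is a unit, then by the Pluecker relation
  \<open>2k - 1\<close> entries fix its determinant matrix; otherwise \<open>p\<close> can be divided out of the whole matrix.
  Summing over the powers of \<open>p\<close> gives \<open>O(q\<^bsup>2k-1\<^esup>)\<close> classes in total.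

  For the lower bound, replace \<open>E\<close> by its primitive vectors. Two configurations with a unit
  determinant are equivalent iff some \<open>g\<close> in \<open>SL\<^sub>2\<close> maps one to the other, so by Cauchy-Schwarz it
  suffices to bound the \<open>(k+1)\<close>-st moment over \<open>g\<close> of \<open>|E \<inter> g\<^bsup>-1\<^esup>E|\<close>. This follows from a bound for its
  variance. With \<open>h = 1\<^sub>E - |E|/|V|\<close>, \<open>V\<close> being the set of primitive vectors, the variance is the sum of
  \<open>h(x) h(x') h(gx) h(gx')\<close> over \<open>g\<close> and over pairs \<open>x, x'\<close>. Pairs with non-unit determinant are rare. On
  pairs of unit determinant \<open>d\<close> the action is simply transitive, which gives the square of the sum of
  \<open>h(x) h(x')\<close> over these pairs; this is estimated by the sums of \<open>h\<close> over lines, i.e. by the quadratic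
  form with kernel \<open>K(y - z)\<close>, where \<open>K(w)\<close> counts the primitive vectors orthogonal to \<open>w\<close>.
\<close>

section \<open>Determinant matrices\<close>

definition cross :: "int \<times> int \<Rightarrow> int \<times> int \<Rightarrow> int" where
  "cross x y = fst x * snd y - snd x * fst y"

lemma dot_perp_cross: "dot_perp q x y = cross x y mod q"
  by (simp add: dot_perp_def cross_def)

lemma cross_pluecker: "cross a b * cross c d = cross a c * cross b d - cross a d * cross b c"
  by (simp add: cross_def algebra_simps)

text \<open>The zeros off the index range turn equality of functions into equality of finite
  matrices. Points are arbitrary integer vectors, so \<open>range\<close> collects the matrices of
  all configurations at once.\<close>

definition det_matrix :: "int \<Rightarrow> nat \<Rightarrow> (nat \<Rightarrow> int \<times> int) \<Rightarrow> nat \<Rightarrow> nat \<Rightarrow> int" where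
  "det_matrix q k x = (\<lambda>i j. if i \<le> k \<and> j \<le> k then cross (x i) (x j) mod q else 0)"

lemma det_matrix_eq_iff:
  "det_matrix q k x = det_matrix q k y \<longleftrightarrow>
     (\<forall>i\<le>k. \<forall>j\<le>k. cross (x i) (x j) mod q = cross (y i) (y j) mod q)"
  by (auto simp: det_matrix_def fun_eq_iff)

text \<open>The classes are the nonempty fibres of \<open>f\<close>, which correspond to its
  values.\<close>

lemma card_quotient_fibres:
  assumes "r = {(x, y). x \<in> A \<and> y \<in> A \<and> f x = f y}"
  shows "card (A // r) = card (f ` A)"
proof -
  have "A // r = (\<lambda>a. r `` {a}) ` A"
    by (auto simp: quotient_def)
  also have "\<dots> = (\<lambda>a. {y \<in> A. f y = f a}) ` A"
    by (rule image_cong) (auto simp: assms)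
  also have "\<dots> = (\<lambda>d. {y \<in> A. f y = d}) ` (f ` A)"
    by (simp only: image_image)
  finally have "A // r = (\<lambda>d. {y \<in> A. f y = d}) ` (f ` A)" .
  moreover have "inj_on (\<lambda>d. {y \<in> A. f y = d}) (f ` A)"
    by (rule inj_onI) blast
  ultimately show ?thesis
    by (simp add: card_image)
qed

lemma card_Cconf:
  "card (Cconf q E k) = card ((\<lambda>xs. det_matrix q k ((!) xs)) ` configs E k)"
  unfolding Cconf_def
  by (rule card_quotient_fibres)
     (simp add: config_rel_def dot_perp_cross det_matrix_eq_iff)

lemma finite_range_det_matrix:
  assumes "q > 0"
  shows "finite (range (det_matrix q k))"
proof -
  let ?F = "\<lambda>M i j. if i \<le> k \<and> j \<le> k then M (i, j) else (0::int)"
  have "det_matrix q k x \<in> ?F ` (PiE ({..k} \<times> {..k}) (\<lambda>_. {0..<q}))" for x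
    by (rule image_eqI[where x = "restrict (\<lambda>(i, j). det_matrix q k x i j) ({..k} \<times> {..k})"])
       (use assms in \<open>auto simp: det_matrix_def fun_eq_iff\<close>)
  moreover have "finite (?F ` (PiE ({..k} \<times> {..k}) (\<lambda>_. {0..<q})))"
    by (intro finite_imageI finite_PiE) auto
  ultimately show ?thesis
    by (meson finite_subset image_subsetI)
qed

section \<open>Upper bound for the number of determinant matrices\<close>

lemma coprime_int_inverse:
  fixes a q :: int
  assumes "coprime a q"
  shows "\<exists>e. q dvd e * a - 1"
proof -
  obtain u v where "u * a + v * q = 1"
    using bezout_int[of a q] assms by auto
  then have "u * a - 1 = q * (- v)"
    by (simp add: algebra_simps)
  then show ?thesis
    by (metis dvd_triv_left)
qed

lemma prime_power_cancel:
  fixes p :: int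
  assumes "prime p" "\<not> p dvd a" "p ^ l dvd a * t"
  shows "p ^ l dvd t"
  using assms by (meson coprime_dvd_mult_right_iff coprime_power_left_iff prime_imp_coprime)

text \<open>Rows \<open>i\<close> and \<open>j\<close> determine the matrix: the Pluecker relation
  gives every entry times the unit entry at \<open>(i, j)\<close>. Row \<open>i\<close> has
  \<open>k\<close> entries off the diagonal; row \<open>j\<close> adds \<open>k - 1\<close>, its
  entry at \<open>i\<close> being fixed by antisymmetry.\<close>

lemma card_det_matrix_unit_entry:
  fixes p :: int
  assumes p: "prime p" and ij: "i \<le> k" "j \<le> k"
  shows "card {D \<in> range (det_matrix (p ^ l) k). \<not> p dvd D i j} \<le> nat (p ^ l) ^ (2 * k - 1)"
proof (cases "i = j \<or> l = 0")
  case True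
  \<comment> \<open>Here the entry is 0: a determinant of two equal points, or a residue mod
    1.\<close>
  then have "{D \<in> range (det_matrix (p ^ l) k). \<not> p dvd D i j} = {}"
    by (auto simp: det_matrix_def cross_def)
  then show ?thesis by (metis card.empty le0)
next
  case False
  then have "i \<noteq> j" "l > 0" by auto
  define q where "q = p ^ l"
  have q: "q > 0" "p dvd q"
    using p \<open>l > 0\<close> by (auto simp: q_def prime_gt_0_int)
  let ?S = "{D \<in> range (det_matrix q k). \<not> p dvd D i j}"
  let ?I = "{..k} - {i}" and ?J = "{..k} - {i, j}"
  let ?P = "PiE ?I (\<lambda>_. {0..<q}) \<times> PiE ?J (\<lambda>_. {0..<q})"
  define F where "F = (\<lambda>D :: nat \<Rightarrow> nat \<Rightarrow> int. (restrict (D i) ?I, restrict (D j) ?J))"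
  have "inj_on F ?S"
  proof (rule inj_onI)
    fix D D' assume *: "D \<in> ?S" "D' \<in> ?S" "F D = F D'"
    obtain x y where xy: "D = det_matrix q k x" "D' = det_matrix q k y"
      using * by auto
    have rowi: "cross (x i) (x m) mod q = cross (y i) (y m) mod q" if "m \<le> k" for m
    proof (cases "m = i")
      case False
      then have "D i m = D' i m"
        using * that by (auto simp: F_def fun_eq_iff restrict_def split: if_splits)
      then show ?thesis using that ij by (simp add: xy det_matrix_def)
    qed (simp add: cross_def)
    have rowj: "cross (x j) (x m) mod q = cross (y j) (y m) mod q" if "m \<le> k" for m
    proof -
      consider "m = i" | "m = j" | "m \<notin> {i, j}" by auto
      then show ?thesis
      proof cases
        case 1
        have "(- cross (x i) (x j)) mod q = (- cross (y i) (y j)) mod q"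
          using rowi[OF ij(2)] by (metis mod_minus_eq)
        then show ?thesis by (simp add: 1 cross_def algebra_simps)
      next
        case 3
        then have "D j m = D' j m"
          using * that by (auto simp: F_def fun_eq_iff restrict_def split: if_splits)
        then show ?thesis using that ij by (simp add: xy det_matrix_def)
      qed (simp add: cross_def)
    qed
    have unit: "\<not> p dvd cross (x i) (x j)"
      using * ij q by (auto simp: xy det_matrix_def dvd_mod_iff)
    have "cross (x m) (x n) mod q = cross (y m) (y n) mod q" if "m \<le> k" "n \<le> k" for m n
    proof -
      have "(cross (x i) (x m) * cross (x j) (x n) - cross (x i) (x n) * cross (x j) (x m)) mod q
            = (cross (y i) (y m) * cross (y j) (y n) - cross (y i) (y n) * cross (y j) (y m)) mod q"
        by (intro mod_diff_cong mod_mult_cong rowi rowj that)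
      then have "(cross (x i) (x j) * cross (x m) (x n)) mod q
            = (cross (y i) (y j) * cross (y m) (y n)) mod q"
        by (simp only: cross_pluecker[symmetric])
      also have "\<dots> = (cross (x i) (x j) * cross (y m) (y n)) mod q"
        by (intro mod_mult_cong refl rowi[OF ij(2), symmetric])
      finally have "q dvd cross (x i) (x j) * (cross (x m) (x n) - cross (y m) (y n))"
        by (simp add: mod_eq_dvd_iff right_diff_distrib)
      then show ?thesis
        unfolding q_def mod_eq_dvd_iff by (rule prime_power_cancel[OF p unit])
    qed
    then show "D = D'" by (simp add: xy det_matrix_eq_iff)
  qed
  moreover have "F ` ?S \<subseteq> ?P"
  proof (rule image_subsetI)
    fix D assume "D \<in> ?S"
    then have "D a b \<in> {0..<q}" for a b
      using q by (auto simp: det_matrix_def)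
    then show "F D \<in> ?P"
      by (simp only: F_def mem_Sigma_iff restrict_PiE_iff) blast
  qed
  moreover have "finite ?P"
    by (intro finite_cartesian_product finite_PiE) auto
  ultimately have "card ?S \<le> card ?P"
    by (rule card_inj_on_le)
  also have "\<dots> = nat q ^ k * nat q ^ (k - 1)"
    using ij \<open>i \<noteq> j\<close> by (simp add: card_cartesian_product card_PiE card_Diff_subset)
  also have "\<dots> = nat q ^ (2 * k - 1)"
    using ij \<open>i \<noteq> j\<close> by (cases k) (auto simp: mult_2 simp flip: power_add)
  finally show ?thesis by (simp add: q_def)
qed

text \<open>If all determinants vanish mod \<open>p\<close>, the points lie on a line mod \<open>p\<close>; a unimodular map sends it
  to the first axis, and then \<open>p\<close> can be divided out of the second coordinates.\<close>

lemma cross_divide_prime: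
  fixes p :: int and x :: "'a \<Rightarrow> int \<times> int"
  assumes p: "prime p" and dvd: "\<And>i j. i \<in> I \<Longrightarrow> j \<in> I \<Longrightarrow> p dvd cross (x i) (x j)"
  obtains y where "\<And>i j. i \<in> I \<Longrightarrow> j \<in> I \<Longrightarrow> cross (x i) (x j) = p * cross (y i) (y j)"
proof (cases "\<exists>m\<in>I. \<not> p dvd fst (x m)")
  case True
  then obtain m where m: "m \<in> I" "\<not> p dvd fst (x m)" by auto
  then have "coprime (fst (x m)) p"
    using p prime_imp_coprime coprime_commute by blast
  then obtain c0 where c0: "p dvd c0 * fst (x m) - 1"
    using coprime_int_inverse by blast
  \<comment> \<open>Mod \<open>p\<close> all points lie on the line of slope \<open>c\<close>; the
    shear (a, b) -> (a, b - c a) preserves determinants and moves it to the first axis.\<close>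
  define c where "c = c0 * snd (x m)"
  have c: "p dvd snd (x m) - fst (x m) * c"
  proof -
    have "snd (x m) - fst (x m) * c = - (snd (x m) * (c0 * fst (x m) - 1))"
      by (simp add: c_def algebra_simps)
    then show ?thesis using c0 by simp
  qed
  have div: "p dvd snd (x i) - c * fst (x i)" if "i \<in> I" for i
  proof -
    have "fst (x m) * (snd (x i) - c * fst (x i))
          = cross (x m) (x i) + fst (x i) * (snd (x m) - fst (x m) * c)"
      by (simp add: cross_def algebra_simps)
    then have "p dvd fst (x m) * (snd (x i) - c * fst (x i))"
      using dvd[OF m(1) that] c by simp
    then show ?thesis
      using m p by (simp add: prime_dvd_mult_iff)
  qed
  define y where "y = (\<lambda>i. (fst (x i), (snd (x i) - c * fst (x i)) div p))"
  have "cross (x i) (x j) = p * cross (y i) (y j)" if "i \<in> I" "j \<in> I" for i j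
  proof -
    have "p * cross (y i) (y j) = fst (x i) * (p * snd (y j)) - (p * snd (y i)) * fst (x j)"
      by (simp add: y_def cross_def algebra_simps)
    also have "\<dots> = cross (x i) (x j)"
      using div that by (simp add: y_def cross_def algebra_simps)
    finally show ?thesis by simp
  qed
  then show ?thesis by (rule that)
next
  case False
  \<comment> \<open>Mod \<open>p\<close> all points lie on the second axis; the quarter turn (a, b)
    -> (-b, a) makes the divisible coordinate the second one.\<close>
  define y where "y = (\<lambda>i. (- snd (x i), fst (x i) div p))"
  have "cross (x i) (x j) = p * cross (y i) (y j)" if "i \<in> I" "j \<in> I" for i j
  proof -
    have "p * cross (y i) (y j) = (p * snd (y i)) * snd (x j) - snd (x i) * (p * snd (y j))"
      by (simp add: y_def cross_def algebra_simps)
    also have "\<dots> = cross (x i) (x j)"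
      using False that by (simp add: y_def cross_def)
    finally show ?thesis by simp
  qed
  then show ?thesis by (rule that)
qed

text \<open>Induction on \<open>l\<close>: a matrix either has a unit entry, in one of (k+1)^2
  positions, or is \<open>p\<close> times a matrix for the next lower power. The factor 2 sums a
  geometric series whose ratio 1/p^(2k-1) is at most 1/2.\<close>

lemma card_range_det_matrix:
  fixes p :: int
  assumes p: "prime p" and k: "k \<ge> 1"
  shows "card (range (det_matrix (p ^ l) k)) \<le> 2 * (k + 1)\<^sup>2 * nat (p ^ l) ^ (2 * k - 1)"
proof (induction l)
  case 0
  have "det_matrix (p ^ 0) k = (\<lambda>_ _ _. 0)"
    by (simp add: det_matrix_def fun_eq_iff)
  then show ?case by simp
next
  case (Suc l)
  let ?R = "\<lambda>l. range (det_matrix (p ^ l) k)"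
  let ?U = "\<lambda>(i, j). {D \<in> ?R (Suc l). \<not> p dvd D i j}"
  have p2: "p \<ge> 2" using p prime_ge_2_int by simp
  have fin: "finite (?R l)" for l
    by (rule finite_range_det_matrix) (use p2 in simp)
  have "?R (Suc l) \<subseteq> (\<Union>ij\<in>{..k} \<times> {..k}. ?U ij) \<union> (\<lambda>D i j. p * D i j) ` ?R l"
  proof
    fix D assume D: "D \<in> ?R (Suc l)"
    then obtain x where x: "D = det_matrix (p ^ Suc l) k x" by auto
    show "D \<in> (\<Union>ij\<in>{..k} \<times> {..k}. ?U ij) \<union> (\<lambda>D i j. p * D i j) ` ?R l"
    proof (cases "\<exists>i\<le>k. \<exists>j\<le>k. \<not> p dvd D i j")
      case True
      then show ?thesis using D by auto
    next
      case False
      then have "p dvd cross (x i) (x j)" if "i \<in> {..k}" "j \<in> {..k}" for i j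
        using that by (auto simp: x det_matrix_def dvd_mod_iff)
      then obtain y where y: "\<And>i j. i \<in> {..k} \<Longrightarrow> j \<in> {..k} \<Longrightarrow>
          cross (x i) (x j) = p * cross (y i) (y j)"
        using cross_divide_prime[OF p, of "{..k}" x] by blast
      \<comment> \<open>The modulus drops by one power because
        \<open>(p * a) mod p ^ Suc l = p * (a mod p ^ l)\<close>.\<close>
      have "D = (\<lambda>i j. p * det_matrix (p ^ l) k y i j)"
        by (auto simp: x det_matrix_def fun_eq_iff y)
      then show ?thesis by blast
    qed
  qed
  then have "card (?R (Suc l)) \<le> card ((\<Union>ij\<in>{..k} \<times> {..k}. ?U ij) \<union> (\<lambda>D i j. p * D i j) ` ?R l)"
    by (rule card_mono[rotated]) (use fin[of l] finite_subset[OF _ fin[of "Suc l"]] in auto)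
  also have "\<dots> \<le> card (\<Union>ij\<in>{..k} \<times> {..k}. ?U ij) + card ((\<lambda>D i j. p * D i j) ` ?R l)"
    by (rule card_Un_le)
  also have "\<dots> \<le> (\<Sum>ij\<in>{..k} \<times> {..k}. card (?U ij)) + card (?R l)"
    by (intro add_mono card_UN_le card_image_le fin) auto
  also have "\<dots> \<le> (\<Sum>ij\<in>{..k} \<times> {..k}. nat (p ^ Suc l) ^ (2 * k - 1))
                   + 2 * (k + 1)\<^sup>2 * nat (p ^ l) ^ (2 * k - 1)"
    using card_det_matrix_unit_entry[OF p, of _ k _ "Suc l"]
    by (intro add_mono sum_mono Suc.IH) auto
  also have "\<dots> = (k + 1)\<^sup>2 * (nat (p ^ Suc l) ^ (2 * k - 1) + 2 * nat (p ^ l) ^ (2 * k - 1))"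
    by (simp add: card_cartesian_product power2_eq_square algebra_simps)
  also have "2 * nat (p ^ l) ^ (2 * k - 1) \<le> nat (p ^ Suc l) ^ (2 * k - 1)"
  proof -
    have "2 ^ 1 \<le> nat p ^ 1"
      using p2 by simp
    also have "\<dots> \<le> nat p ^ (2 * k - 1)"
      using p2 k by (intro power_increasing) auto
    finally have "2 ^ 1 \<le> nat p ^ (2 * k - 1)" .
    then have "2 * nat (p ^ l) ^ (2 * k - 1) \<le> nat p ^ (2 * k - 1) * nat (p ^ l) ^ (2 * k - 1)"
      by (intro mult_right_mono) auto
    then show ?thesis using p2 by (simp add: nat_mult_distrib power_mult_distrib)
  qed
  finally show ?case by (simp add: algebra_simps)
qed

lemma card_Cconf_le:
  fixes p :: int
  assumes "prime p" "k \<ge> 1"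
  shows "card (Cconf (p ^ l) E k) \<le> 2 * (k + 1)\<^sup>2 * nat (p ^ l) ^ (2 * k - 1)"
proof -
  have "card (Cconf (p ^ l) E k) \<le> card (range (det_matrix (p ^ l) k))"
    unfolding card_Cconf using assms
    by (intro card_mono finite_range_det_matrix) (auto simp: prime_gt_0_int)
  with card_range_det_matrix[OF assms] show ?thesis
    by (rule order.trans[rotated])
qed

section \<open>Cauchy-Schwarz over fibres and the Schur test\<close>

lemma sum_fibres_squared:
  fixes h :: "'a \<Rightarrow> real"
  assumes "finite A" "finite D" "\<phi> ` A \<subseteq> D"
  shows "(\<Sum>d\<in>D. (\<Sum>y\<in>{y \<in> A. \<phi> y = d}. h y)\<^sup>2)
         = (\<Sum>y\<in>A. h y * (\<Sum>y'\<in>{y' \<in> A. \<phi> y' = \<phi> y}. h y'))"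
proof -
  define S where "S d = (\<Sum>y\<in>{y \<in> A. \<phi> y = d}. h y)" for d
  \<comment> \<open>Both sides of the claim are the sum of \<open>h y * h y'\<close> over pairs in a
    common fibre.\<close>
  have "(\<Sum>d\<in>D. (S d)\<^sup>2) = (\<Sum>d\<in>D. \<Sum>y\<in>{y \<in> A. \<phi> y = d}. h y * S (\<phi> y))"
  proof (rule sum.cong[OF refl])
    fix d
    have "(\<Sum>y\<in>{y \<in> A. \<phi> y = d}. h y * S (\<phi> y)) = (\<Sum>y\<in>{y \<in> A. \<phi> y = d}. h y * S d)"
      by (rule sum.cong) auto
    then show "(S d)\<^sup>2 = (\<Sum>y\<in>{y \<in> A. \<phi> y = d}. h y * S (\<phi> y))"
      by (simp add: power2_eq_square sum_distrib_right[symmetric] flip: S_def)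
  qed
  also have "\<dots> = (\<Sum>y\<in>A. h y * S (\<phi> y))"
    by (rule sum.group) (use assms in auto)
  finally show ?thesis by (simp add: S_def)
qed

text \<open>Cauchy-Schwarz for the fibre sizes. Applied to determinant matrices, it bounds the
  number of classes from below once equivalent pairs are few.\<close>

lemma card_squared_le_card_image:
  assumes "finite A"
  shows "(card A)\<^sup>2 \<le> card (f ` A) * card {(x, y). x \<in> A \<and> y \<in> A \<and> f y = f x}"
proof -
  let ?S = "\<lambda>d. \<Sum>y\<in>{y \<in> A. f y = d}. 1 :: real"
  have "real (card A) = (\<Sum>d\<in>f ` A. 1 * ?S d)"
    using sum.group[of A "f ` A" f "\<lambda>_. 1 :: real"] assms by simp
  then have "(real (card A))\<^sup>2 \<le> (\<Sum>d\<in>f ` A. 1\<^sup>2) * (\<Sum>d\<in>f ` A. (?S d)\<^sup>2)"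
    using Cauchy_Schwarz_ineq_sum[of "\<lambda>_. 1" ?S "f ` A"] by simp
  also have "(\<Sum>d\<in>f ` A. (?S d)\<^sup>2) = (\<Sum>y\<in>A. 1 * ?S (f y))"
    by (rule sum_fibres_squared) (use assms in auto)
  also have "\<dots> = real (card (Sigma A (\<lambda>x. {y \<in> A. f y = f x})))"
    using assms by (simp add: card_SigmaI)
  also have "Sigma A (\<lambda>x. {y \<in> A. f y = f x}) = {(x, y). x \<in> A \<and> y \<in> A \<and> f y = f x}"
    by auto
  finally have "real ((card A)\<^sup>2) \<le> real (card (f ` A) * card {(x, y). x \<in> A \<and> y \<in> A \<and> f y = f x})"
    by simp
  then show ?thesis by (simp only: of_nat_le_iff)
qed

text \<open>Twice \<open>|h y * h y'|\<close> is at most the sum of the two squares. Symmetry of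
  \<open>B\<close> makes the two resulting sums equal, and each row costs at most
  \<open>M\<close>.\<close>

lemma schur_test:
  fixes h :: "'a \<Rightarrow> real" and B :: "'a \<Rightarrow> 'a \<Rightarrow> real"
  assumes sym: "\<And>y y'. y \<in> A \<Longrightarrow> y' \<in> A \<Longrightarrow> B y y' = B y' y"
    and row: "\<And>y. y \<in> A \<Longrightarrow> (\<Sum>y'\<in>A. \<bar>B y y'\<bar>) \<le> M"
  shows "(\<Sum>y\<in>A. \<Sum>y'\<in>A. h y * h y' * B y y') \<le> M * (\<Sum>y\<in>A. (h y)\<^sup>2)"
proof -
  have "h y * h y' * B y y' \<le> (h y)\<^sup>2 * \<bar>B y y'\<bar> / 2 + (h y')\<^sup>2 * \<bar>B y y'\<bar> / 2" for y y'
  proof -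
    have "h y * h y' * B y y' \<le> \<bar>h y\<bar> * \<bar>h y'\<bar> * \<bar>B y y'\<bar>"
      by (metis abs_ge_self abs_mult)
    also have "\<dots> \<le> ((h y)\<^sup>2 / 2 + (h y')\<^sup>2 / 2) * \<bar>B y y'\<bar>"
      using sum_squares_bound[of "\<bar>h y\<bar>" "\<bar>h y'\<bar>"] by (intro mult_right_mono) auto
    finally show ?thesis by (simp add: algebra_simps)
  qed
  then have "(\<Sum>y\<in>A. \<Sum>y'\<in>A. h y * h y' * B y y')
      \<le> (\<Sum>y\<in>A. \<Sum>y'\<in>A. (h y)\<^sup>2 * \<bar>B y y'\<bar> / 2 + (h y')\<^sup>2 * \<bar>B y y'\<bar> / 2)"
    by (intro sum_mono)
  also have "\<dots> = (\<Sum>y\<in>A. \<Sum>y'\<in>A. (h y)\<^sup>2 * \<bar>B y y'\<bar> / 2) + (\<Sum>y\<in>A. \<Sum>y'\<in>A. (h y')\<^sup>2 * \<bar>B y y'\<bar> / 2)"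
    by (simp add: sum.distrib)
  also have "(\<Sum>y\<in>A. \<Sum>y'\<in>A. (h y')\<^sup>2 * \<bar>B y y'\<bar> / 2) = (\<Sum>y\<in>A. \<Sum>y'\<in>A. (h y)\<^sup>2 * \<bar>B y y'\<bar> / 2)"
    by (subst sum.swap) (auto intro!: sum.cong simp: sym)
  also have "(\<Sum>y\<in>A. \<Sum>y'\<in>A. (h y)\<^sup>2 * \<bar>B y y'\<bar> / 2) + (\<Sum>y\<in>A. \<Sum>y'\<in>A. (h y)\<^sup>2 * \<bar>B y y'\<bar> / 2)
      = (\<Sum>y\<in>A. (h y)\<^sup>2 * (\<Sum>y'\<in>A. \<bar>B y y'\<bar>))"
    by (simp add: sum_distrib_left mult.commute flip: sum.distrib)
  also have "\<dots> \<le> (\<Sum>y\<in>A. (h y)\<^sup>2 * M)"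
    using row by (intro sum_mono mult_left_mono) auto
  finally show ?thesis by (simp add: sum_distrib_left mult.commute)
qed

section \<open>Primitive vectors modulo a prime power\<close>

definition primitive :: "int \<Rightarrow> int \<times> int \<Rightarrow> bool" where
  "primitive p x \<longleftrightarrow> \<not> (p dvd fst x \<and> p dvd snd x)"

definition act :: "int \<Rightarrow> (int \<times> int) \<times> (int \<times> int) \<Rightarrow> int \<times> int \<Rightarrow> int \<times> int" where
  "act q g x = ((fst (fst g) * fst x + fst (snd g) * snd x) mod q,
                (snd (fst g) * fst x + snd (snd g) * snd x) mod q)"

text \<open>\<open>r\<close> is q/p, the number of residues mod \<open>q\<close> in one residue
  class mod \<open>p\<close>. Replacing a factor \<open>q\<close> by \<open>r\<close> is the saving
  of 1/p in the counts below.\<close>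

locale prime_power_plane =
  fixes p :: int and l :: nat and q r :: int
  assumes p: "prime p" and l: "l \<ge> 1" and q_def: "q = p ^ l" and r_def: "r = p ^ (l - 1)"
begin

definition V :: "(int \<times> int) set" where
  "V = {x \<in> ZmodSq q. primitive p x}"

text \<open>A matrix in \<open>SL\<^sub>2\<close> is encoded as the pair of its columns.\<close>

definition SL2 :: "((int \<times> int) \<times> (int \<times> int)) set" where
  "SL2 = {(u, v). u \<in> ZmodSq q \<and> v \<in> ZmodSq q \<and> q dvd cross u v - 1}"

lemma q_eq: "q = r * p"
  using l by (cases l) (auto simp: q_def r_def)

lemma p_gt1: "p > 1" and r_pos: "r > 0" and q_pos: "q > 0" and p_dvd_q: "p dvd q"
  using p l prime_gt_1_int[OF p] by (auto simp: q_def r_def)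

lemma cancel_unit: "\<not> p dvd a \<Longrightarrow> q dvd a * t \<Longrightarrow> q dvd t"
  unfolding q_def by (rule prime_power_cancel[OF p])

lemma cong_imp_eq: "a = b" if "q dvd a - b" "a \<in> {0..<q}" "b \<in> {0..<q}"
  using that by (metis atLeastLessThan_iff mod_eq_dvd_iff mod_pos_pos_trivial)

lemma ZmodSq_eqI: "x = y"
  if "x \<in> ZmodSq q" "y \<in> ZmodSq q" "q dvd fst x - fst y" "q dvd snd x - snd y"
  using that cong_imp_eq by (auto simp: ZmodSq_def prod_eq_iff)

lemma finite_ZmodSq [simp]: "finite (ZmodSq q)"
  by (simp add: ZmodSq_def)

lemma finite_V [simp]: "finite V"
  by (simp add: V_def)

lemma finite_SL2 [simp]: "finite SL2"
  by (rule finite_subset[of _ "ZmodSq q \<times> ZmodSq q"]) (auto simp: SL2_def)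

lemma V_ZmodSq: "x \<in> V \<Longrightarrow> x \<in> ZmodSq q" and V_primitive: "x \<in> V \<Longrightarrow> primitive p x"
  by (auto simp: V_def)

section \<open>Counting residues and points on lines\<close>

lemma inj_on_div_p: "inj_on (\<lambda>t. t div p) {t. p dvd a * t - s}" if "\<not> p dvd a"
proof (rule inj_onI)
  fix t t' assume *: "t \<in> {t. p dvd a * t - s}" "t' \<in> {t. p dvd a * t - s}" "t div p = t' div p"
  \<comment> \<open>The congruence fixes \<open>t\<close> mod \<open>p\<close>, after which the
    quotient fixes \<open>t\<close>.\<close>
  then have "p dvd a * (t - t')"
    using dvd_diff[of p "a * t - s" "a * t' - s"] by (simp add: right_diff_distrib)
  then have "p dvd t - t'"
    using that p by (simp add: prime_dvd_mult_iff)
  then have "t mod p = t' mod p"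
    by (simp add: mod_eq_dvd_iff)
  with *(3) show "t = t'"
    by (metis div_mult_mod_eq)
qed

lemma div_p_range: "t div p \<in> {0..<r}" if "t \<in> {0..<q}"
proof -
  have "t div p < r"
  proof (rule ccontr)
    assume "\<not> t div p < r"
    then have "r * p \<le> (t div p) * p" using p_gt1 by simp
    also have "\<dots> \<le> t" using p_gt1 div_mult_mod_eq[of t p] pos_mod_sign[of p t] by linarith
    finally show False using that by (simp add: q_eq)
  qed
  then show ?thesis
    using that p_gt1 by (simp add: pos_imp_zdiv_nonneg_iff)
qed

lemma card_residue_le: "card {t \<in> {0..<q}. p dvd t - s} \<le> nat r"
proof -
  have "card {t \<in> {0..<q}. p dvd t - s} \<le> card {0..<r}"
    by (rule card_inj_on_le[where f = "\<lambda>t. t div p"])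
       (use p_gt1 in \<open>auto intro: inj_on_subset[OF inj_on_div_p[of 1 s]]
          simp del: atLeastLessThan_iff simp: div_p_range\<close>)
  then show ?thesis by simp
qed

lemma card_congruent_le:
  "card {y \<in> ZmodSq q. p dvd fst y - fst z \<and> p dvd snd y - snd z} \<le> nat r * nat r"
proof -
  have "{y \<in> ZmodSq q. p dvd fst y - fst z \<and> p dvd snd y - snd z}
        = {t \<in> {0..<q}. p dvd t - fst z} \<times> {t \<in> {0..<q}. p dvd t - snd z}"
    by (auto simp: ZmodSq_def)
  then show ?thesis
    by (simp only: card_cartesian_product) (intro mult_mono card_residue_le; simp)
qed

text \<open>Some coordinate of \<open>x\<close> is a unit. The coordinate of \<open>y\<close> that
  it multiplies is fixed mod \<open>p\<close> by the other one: \<open>q\<close> choices times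
  \<open>r\<close> choices.\<close>

lemma card_cross_dvd_le:
  assumes "primitive p x"
  shows "card {y \<in> ZmodSq q. p dvd cross x y} \<le> nat q * nat r"
proof -
  let ?S = "{y \<in> ZmodSq q. p dvd cross x y}"
  consider "\<not> p dvd fst x" | "\<not> p dvd snd x"
    using assms by (auto simp: primitive_def)
  then show ?thesis
  proof cases
    case 1
    have "inj_on (\<lambda>y. (fst y, snd y div p)) ?S"
      using inj_on_div_p[OF 1] by (auto simp: inj_on_def cross_def)
    then have "card ?S \<le> card ({0..<q} \<times> {0..<r})"
      by (rule card_inj_on_le) (auto simp: ZmodSq_def div_p_range[simplified])
    then show ?thesis by (simp add: card_cartesian_product)
  next
    case 2
    have "inj_on (\<lambda>y. (fst y div p, snd y)) ?S"
      using inj_on_div_p[OF 2] by (auto simp: inj_on_def cross_def dvd_diff_commute)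
    then have "card ?S \<le> card ({0..<r} \<times> {0..<q})"
      by (rule card_inj_on_le) (auto simp: ZmodSq_def div_p_range[simplified])
    then show ?thesis by (simp add: card_cartesian_product mult.commute)
  qed
qed

text \<open>On a line with primitive coefficients one coordinate determines the other; which one
  depends on the unit coordinate of \<open>x\<close>. Stated as injectivity, it serves both the
  count \<open>q\<close> of all points and the count \<open>r\<close> within a residue class mod
  \<open>p\<close>.\<close>

lemma inj_on_coordinate:
  assumes "primitive p x"
  shows "inj_on fst {y \<in> ZmodSq q. q dvd cross x y - d} \<or> inj_on snd {y \<in> ZmodSq q. q dvd cross x y - d}"
proof -
  have diff: "q dvd fst x * (snd y - snd y') - snd x * (fst y - fst y')"
    if "q dvd cross x y - d" "q dvd cross x y' - d" for y y'
    using dvd_diff[OF that] by (simp add: cross_def algebra_simps)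
  consider "\<not> p dvd fst x" | "\<not> p dvd snd x"
    using assms by (auto simp: primitive_def)
  then show ?thesis
  proof cases
    case 1
    have "inj_on fst {y \<in> ZmodSq q. q dvd cross x y - d}"
    proof (rule inj_onI)
      fix y y' assume y: "y \<in> {y \<in> ZmodSq q. q dvd cross x y - d}" "y' \<in> {y \<in> ZmodSq q. q dvd cross x y - d}"
        and eq: "fst y = fst y'"
      then have "q dvd fst x * (snd y - snd y')"
        using diff[of y y'] by simp
      then have "q dvd snd y - snd y'"
        by (rule cancel_unit[OF 1])
      then show "y = y'"
        using y eq by (intro ZmodSq_eqI) auto
    qed
    then show ?thesis ..
  next
    case 2
    have "inj_on snd {y \<in> ZmodSq q. q dvd cross x y - d}"
    proof (rule inj_onI)
      fix y y' assume y: "y \<in> {y \<in> ZmodSq q. q dvd cross x y - d}" "y' \<in> {y \<in> ZmodSq q. q dvd cross x y - d}"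
        and eq: "snd y = snd y'"
      then have "q dvd snd x * (fst y - fst y')"
        using diff[of y y'] by simp
      then have "q dvd fst y - fst y'"
        by (rule cancel_unit[OF 2])
      then show "y = y'"
        using y eq by (intro ZmodSq_eqI) auto
    qed
    then show ?thesis ..
  qed
qed

lemma card_cross_eq_le:
  assumes "primitive p x"
  shows "card {y \<in> ZmodSq q. q dvd cross x y - d} \<le> nat q"
proof -
  have "card {y \<in> ZmodSq q. q dvd cross x y - d} \<le> card {0..<q}"
    using inj_on_coordinate[OF assms, of d]
    by (elim disjE; intro card_inj_on_le) (auto simp: ZmodSq_def)
  then show ?thesis by simp
qed

lemma card_cross_eq_congruent_le:
  assumes "primitive p x"
  shows "card {y \<in> ZmodSq q. q dvd cross x y - d \<and> p dvd fst y - fst z \<and> p dvd snd y - snd z} \<le> nat r"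
    (is "card ?S \<le> _")
proof -
  have sub: "?S \<subseteq> {y \<in> ZmodSq q. q dvd cross x y - d}" by auto
  from inj_on_coordinate[OF assms, of d] show ?thesis
  proof
    assume "inj_on fst {y \<in> ZmodSq q. q dvd cross x y - d}"
    then have "card ?S \<le> card {t \<in> {0..<q}. p dvd t - fst z}"
      by (intro card_inj_on_le[OF inj_on_subset[OF _ sub]]) (auto simp: ZmodSq_def intro: finite_subset[of _ "{0..<q}"])
    then show ?thesis using card_residue_le by (rule order.trans)
  next
    assume "inj_on snd {y \<in> ZmodSq q. q dvd cross x y - d}"
    then have "card ?S \<le> card {t \<in> {0..<q}. p dvd t - snd z}"
      by (intro card_inj_on_le[OF inj_on_subset[OF _ sub]]) (auto simp: ZmodSq_def intro: finite_subset[of _ "{0..<q}"])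
    then show ?thesis using card_residue_le by (rule order.trans)
  qed
qed

text \<open>Since \<open>cross x y\<close> and \<open>cross x z\<close> agree mod \<open>q\<close>
  iff \<open>q\<close> divides \<open>cross x (y - z)\<close>, the value at \<open>y - z\<close>
  counts the primitive \<open>x\<close> that put \<open>y\<close> and \<open>z\<close> on a common
  line.\<close>

definition K :: "int \<times> int \<Rightarrow> nat" where
  "K z = card {x \<in> V. q dvd cross x z}"

lemma unit_inverse:
  assumes "\<not> p dvd a"
  obtains e where "q dvd e * a - 1" "\<not> p dvd e"
proof -
  have "coprime a p"
    using assms p prime_imp_coprime coprime_commute by blast
  then have "coprime a q"
    by (simp add: q_def)
  then obtain e where e: "q dvd e * a - 1"
    using coprime_int_inverse by blast
  moreover have "\<not> p dvd e"
  proof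
    assume "p dvd e"
    moreover have "p dvd e * a - 1" using e p_dvd_q dvd_trans by blast
    ultimately have "p dvd e * a - (e * a - 1)" by (rule dvd_diff[OF dvd_mult2])
    then show False using p_gt1 by simp
  qed
  ultimately show ?thesis by (rule that)
qed

text \<open>A primitive vector spans its own orthogonal complement, freely.\<close>

lemma K_primitive:
  assumes "primitive p z"
  shows "K z = card {t \<in> {0..<q}. \<not> p dvd t}"
proof -
  let ?f = "\<lambda>t. ((t * fst z) mod q, (t * snd z) mod q)"
  let ?U = "{t \<in> {0..<q}. \<not> p dvd t}"
  have ndvd: "p dvd a mod q \<longleftrightarrow> p dvd a" for a
    using p_dvd_q by (simp add: dvd_mod_iff)
  have "inj_on ?f ?U"
  proof (rule inj_onI)
    fix t t' assume *: "t \<in> ?U" "t' \<in> ?U" "?f t = ?f t'"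
    then have "q dvd fst z * (t - t')" "q dvd snd z * (t - t')"
      by (auto simp: mod_eq_dvd_iff algebra_simps)
    then have "q dvd t - t'"
      using assms cancel_unit by (auto simp: primitive_def)
    then show "t = t'" using * cong_imp_eq by auto
  qed
  moreover have "?f ` ?U = {x \<in> V. q dvd cross x z}"
  proof (intro equalityI subsetI)
    fix x assume "x \<in> ?f ` ?U"
    then obtain t where t: "t \<in> ?U" "x = ?f t" by auto
    have "cross x z mod q = (t * fst z * snd z - t * snd z * fst z) mod q"
      unfolding cross_def t(2) fst_conv snd_conv by (intro mod_diff_cong mod_mult_cong) simp_all
    then have "q dvd cross x z" by (simp add: mod_eq_0_iff_dvd algebra_simps)
    moreover have "primitive p x"
      using t assms p by (auto simp: primitive_def ndvd prime_dvd_mult_iff)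
    ultimately show "x \<in> {x \<in> V. q dvd cross x z}"
      using q_pos by (auto simp: V_def ZmodSq_def t(2))
  next
    fix x assume x: "x \<in> {x \<in> V. q dvd cross x z}"
    then have x': "fst x \<in> {0..<q}" "snd x \<in> {0..<q}" "primitive p x" "q dvd cross x z"
      by (auto simp: V_def ZmodSq_def)
    \<comment> \<open>Where a coordinate of \<open>z\<close> is a unit, the vanishing determinant
      forces x = t z, with \<open>t\<close> the quotient of the corresponding coordinates.\<close>
    have "\<exists>t. q dvd t * fst z - fst x \<and> q dvd t * snd z - snd x"
    proof (cases "p dvd fst z")
      case False
      then obtain e where e: "q dvd e * fst z - 1" by (rule unit_inverse)
      have "e * fst x * fst z - fst x = (e * fst z - 1) * fst x"
        "e * fst x * snd z - snd x = e * cross x z + (e * fst z - 1) * snd x"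
        by (auto simp: cross_def algebra_simps)
      then show ?thesis using e x'(4) by (intro exI[of _ "e * fst x"]) auto
    next
      case True
      then have "\<not> p dvd snd z" using assms by (auto simp: primitive_def)
      then obtain e where e: "q dvd e * snd z - 1" by (rule unit_inverse)
      have "e * snd x * snd z - snd x = (e * snd z - 1) * snd x"
        "e * snd x * fst z - fst x = (e * snd z - 1) * fst x - e * cross x z"
        by (auto simp: cross_def algebra_simps)
      then show ?thesis using e x'(4) by (intro exI[of _ "e * snd x"]) auto
    qed
    then obtain t where t: "q dvd t * fst z - fst x" "q dvd t * snd z - snd x" by auto
    then have eq: "x = ?f (t mod q)"
      using x'(1,2) by (auto simp: prod_eq_iff mod_mult_left_eq simp flip: mod_eq_dvd_iff)
    have "\<not> p dvd t"
    proof
      assume "p dvd t"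
      then have "p dvd fst x \<and> p dvd snd x"
        by (subst (1 2) eq) (simp add: ndvd)
      then show False using x'(3) by (simp add: primitive_def)
    qed
    then have "t mod q \<in> ?U" using q_pos by (simp add: ndvd)
    then show "x \<in> ?f ` ?U" using eq by (rule rev_image_eqI)
  qed
  ultimately show ?thesis
    unfolding K_def by (metis (no_types, lifting) card_image)
qed

end

section \<open>The action of SL2\<close>

definition reduce :: "int \<Rightarrow> int \<times> int \<Rightarrow> int \<times> int" where
  "reduce q x = (fst x mod q, snd x mod q)"

lemma cross_reduce: "cross (reduce q x) (reduce q y) mod q = cross x y mod q"
  unfolding cross_def reduce_def fst_conv snd_conv
  by (intro mod_diff_cong mod_mult_cong) simp_all

lemma act_reduce: "act q (reduce q u, reduce q v) x = act q (u, v) x"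
  unfolding act_def reduce_def fst_conv snd_conv prod.inject
  by (intro conjI mod_add_cong mod_mult_cong) simp_all

text \<open>The matrix with columns \<open>g x\<close>, \<open>g y\<close> is the product of
  \<open>g\<close> and the matrix with columns \<open>x\<close>, \<open>y\<close>, and determinants
  multiply.\<close>

lemma cross_act: "cross (act q g x) (act q g y) mod q = (cross (fst g) (snd g) * cross x y) mod q"
proof -
  define m where "m = (\<lambda>x. (fst (fst g) * fst x + fst (snd g) * snd x,
                            snd (fst g) * fst x + snd (snd g) * snd x))"
  have "act q g x = reduce q (m x)" for x
    by (simp add: act_def m_def reduce_def)
  then have "cross (act q g x) (act q g y) mod q = cross (m x) (m y) mod q"
    by (simp add: cross_reduce)
  also have "cross (m x) (m y) = cross (fst g) (snd g) * cross x y"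
    by (simp add: m_def cross_def algebra_simps)
  finally show ?thesis .
qed

context prime_power_plane
begin

lemma dvd_mod_q_iff: "p dvd a mod q \<longleftrightarrow> p dvd a"
  using p_dvd_q by (simp add: dvd_mod_iff)

lemma reduce_ZmodSq: "reduce q x \<in> ZmodSq q"
  using q_pos by (simp add: reduce_def ZmodSq_def)

lemma act_ZmodSq: "act q g x \<in> ZmodSq q"
  using q_pos by (simp add: act_def ZmodSq_def)

lemma act_eqD:
  assumes "act q g x = act q g' x'"
  shows "q dvd (fst (fst g) * fst x + fst (snd g) * snd x) - (fst (fst g') * fst x' + fst (snd g') * snd x')"
    and "q dvd (snd (fst g) * fst x + snd (snd g) * snd x) - (snd (fst g') * fst x' + snd (snd g') * snd x')"
  using assms by (auto simp: act_def mod_eq_dvd_iff)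

lemma cross_act_SL2:
  assumes "g \<in> SL2"
  shows "cross (act q g x) (act q g y) mod q = cross x y mod q"
proof -
  have "cross (fst g) (snd g) mod q = 1 mod q"
    using assms by (auto simp: SL2_def mod_eq_dvd_iff)
  then have "(cross (fst g) (snd g) * cross x y) mod q = (1 * cross x y) mod q"
    by (intro mod_mult_cong) auto
  then show ?thesis by (simp add: cross_act)
qed

lemma primitive_if_cross_unit: "primitive p x" "primitive p y" if "\<not> p dvd cross x y"
  using that by (auto simp: primitive_def cross_def)

text \<open>A standard basis vector serves. With the converse \<open>primitive_if_cross_unit\<close>
  this describes primitivity by determinants, which \<open>SL2\<close> preserves; hence
  \<open>act_V\<close>.\<close>

lemma primitive_partner:
  assumes "primitive p x"
  obtains y where "y \<in> ZmodSq q" "\<not> p dvd cross x y"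
proof (cases "p dvd fst x")
  case True
  with assms have "\<not> p dvd cross x (1 mod q, 0)"
    by (simp add: primitive_def cross_def p prime_dvd_mult_iff dvd_mod_q_iff)
      (use p not_prime_unit in auto)
  then show ?thesis using q_pos by (intro that[of "(1 mod q, 0)"]) (auto simp: ZmodSq_def)
next
  case False
  with assms have "\<not> p dvd cross x (0, 1 mod q)"
    by (simp add: primitive_def cross_def p prime_dvd_mult_iff dvd_mod_q_iff)
      (use p not_prime_unit in auto)
  then show ?thesis using q_pos by (intro that[of "(0, 1 mod q)"]) (auto simp: ZmodSq_def)
qed

lemma act_V:
  assumes "g \<in> SL2" "x \<in> V"
  shows "act q g x \<in> V"
proof -
  obtain y where "\<not> p dvd cross x y"
    using primitive_partner[OF V_primitive[OF assms(2)]] by metis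
  then have "\<not> p dvd cross (act q g x) (act q g y)"
    using cross_act_SL2[OF assms(1)] by (metis dvd_mod_q_iff)
  then show ?thesis
    using primitive_if_cross_unit act_ZmodSq by (auto simp: V_def)
qed

lemma inj_on_act: "inj_on (act q g) V" if "g \<in> SL2"
proof (rule inj_onI)
  fix x y assume V: "x \<in> V" "y \<in> V" and eq: "act q g x = act q g y"
  obtain a c b d where g: "g = ((a, c), (b, d))" by (metis prod.collapse)
  have det: "q dvd (a * d - c * b) - 1"
    using that by (simp add: SL2_def g cross_def)
  have *: "q dvd (a * fst x + b * snd x) - (a * fst y + b * snd y)"
    "q dvd (c * fst x + d * snd x) - (c * fst y + d * snd y)"
    using act_eqD[OF eq] by (simp_all add: g)
  \<comment> \<open>Apply the adjugate matrix with rows (d, -b) and (-c, a); the last term corrects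
    the determinant to 1.\<close>
  have "fst x - fst y = d * ((a * fst x + b * snd x) - (a * fst y + b * snd y))
      - b * ((c * fst x + d * snd x) - (c * fst y + d * snd y)) - ((a * d - c * b) - 1) * (fst x - fst y)"
    by (simp add: algebra_simps)
  moreover have "snd x - snd y = a * ((c * fst x + d * snd x) - (c * fst y + d * snd y))
      - c * ((a * fst x + b * snd x) - (a * fst y + b * snd y)) - ((a * d - c * b) - 1) * (snd x - snd y)"
    by (simp add: algebra_simps)
  ultimately have "q dvd fst x - fst y" "q dvd snd x - snd y"
    using * det by (metis dvd_diff dvd_mult dvd_mult2)+
  then show "x = y"
    using V V_ZmodSq ZmodSq_eqI by blast
qed

lemma bij_betw_act: "bij_betw (act q g) V V" if "g \<in> SL2"
  using that by (intro bij_betw_imageI inj_on_act endo_inj_surj image_subsetI act_V finite_V)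

text \<open>With a unit determinant, \<open>x\<close> and \<open>x'\<close> form a basis, so a
  linear form vanishing on both is 0. The rows of the difference of \<open>g\<close> and
  \<open>g'\<close> are such forms.\<close>

lemma act_pair_inj:
  assumes g: "g \<in> SL2" "g' \<in> SL2" and unit: "\<not> p dvd cross x x'"
    and eq: "act q g x = act q g' x" "act q g x' = act q g' x'"
  shows "g = g'"
proof -
  have zero: "q dvd \<alpha> \<and> q dvd \<beta>"
    if "q dvd \<alpha> * fst x + \<beta> * snd x" "q dvd \<alpha> * fst x' + \<beta> * snd x'" for \<alpha> \<beta>
  proof -
    have "cross x x' * \<alpha> = snd x' * (\<alpha> * fst x + \<beta> * snd x) - snd x * (\<alpha> * fst x' + \<beta> * snd x')"
      "cross x x' * \<beta> = fst x * (\<alpha> * fst x' + \<beta> * snd x') - fst x' * (\<alpha> * fst x + \<beta> * snd x)"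
      by (simp_all add: cross_def algebra_simps)
    then have "q dvd cross x x' * \<alpha>" "q dvd cross x x' * \<beta>"
      using that by (metis dvd_diff dvd_mult)+
    then show ?thesis by (blast intro: cancel_unit[OF unit])
  qed
  have "q dvd fst (fst g) - fst (fst g') \<and> q dvd fst (snd g) - fst (snd g')"
    by (rule zero) (use act_eqD(1)[OF eq(1)] act_eqD(1)[OF eq(2)] in \<open>simp_all add: algebra_simps\<close>)
  moreover have "q dvd snd (fst g) - snd (fst g') \<and> q dvd snd (snd g) - snd (snd g')"
    by (rule zero) (use act_eqD(2)[OF eq(1)] act_eqD(2)[OF eq(2)] in \<open>simp_all add: algebra_simps\<close>)
  moreover have "fst g \<in> ZmodSq q" "snd g \<in> ZmodSq q" "fst g' \<in> ZmodSq q" "snd g' \<in> ZmodSq q"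
    using g by (auto simp: SL2_def)
  ultimately show ?thesis
    by (intro prod_eqI ZmodSq_eqI) auto
qed

text \<open>By Cramer's rule there is only one candidate for the matrix taking \<open>x, x'\<close> to \<open>y, y'\<close>.\<close>

lemma exists_transport:
  assumes unit: "\<not> p dvd cross x x'" and eq: "q dvd cross y y' - cross x x'"
  obtains g where "g \<in> SL2"
    and "\<And>z w. w \<in> ZmodSq q \<Longrightarrow>
           q dvd cross x x' * fst w - (cross z x' * fst y + cross x z * fst y') \<Longrightarrow>
           q dvd cross x x' * snd w - (cross z x' * snd y + cross x z * snd y') \<Longrightarrow> act q g z = w"
proof -
  obtain e where e: "q dvd e * cross x x' - 1"
    using unit_inverse[OF unit] by metis
  \<comment> \<open>Cramer: cross x x' times z is cross z x' times x plus cross x z times x', so the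
    image of z is the same combination of \<open>y\<close>, \<open>y'\<close> divided by
    \<open>cross x x'\<close>. The columns \<open>u\<close>, \<open>v\<close> are this image at (1,
    0) and (0, 1).\<close>
  define u where "u = (e * (snd x' * fst y - snd x * fst y'), e * (snd x' * snd y - snd x * snd y'))"
  define v where "v = (e * (fst x * fst y' - fst x' * fst y), e * (fst x * snd y' - fst x' * snd y))"
  let ?g = "(reduce q u, reduce q v)"
  \<comment> \<open>The determinant of \<open>u\<close>, \<open>v\<close> equals
    \<open>e * e * cross x x' * cross y y'\<close>.\<close>
  have "cross u v - 1 = e * e * cross x x' * (cross y y' - cross x x')
      + (e * cross x x' - 1) * (e * cross x x' + 1)"
    by (simp add: u_def v_def cross_def algebra_simps)
  then have "q dvd cross u v - 1"
    using e eq by (metis dvd_add dvd_mult dvd_mult2)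
  then have "?g \<in> SL2"
    using cross_reduce[of q u v] by (simp add: SL2_def reduce_ZmodSq flip: mod_eq_dvd_iff)
  moreover have "act q ?g z = w" if w: "w \<in> ZmodSq q"
    and 1: "q dvd cross x x' * fst w - (cross z x' * fst y + cross x z * fst y')"
    and 2: "q dvd cross x x' * snd w - (cross z x' * snd y + cross x z * snd y')" for z w
  proof -
    have "fst u * fst z + fst v * snd z - fst w =
       (e * cross x x' - 1) * fst w - e * (cross x x' * fst w - (cross z x' * fst y + cross x z * fst y'))"
      "snd u * fst z + snd v * snd z - snd w =
       (e * cross x x' - 1) * snd w - e * (cross x x' * snd w - (cross z x' * snd y + cross x z * snd y'))"
      by (simp_all add: u_def v_def cross_def algebra_simps)
    then have "q dvd fst u * fst z + fst v * snd z - fst w" "q dvd snd u * fst z + snd v * snd z - snd w"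
      using e 1 2 by (metis dvd_diff dvd_mult dvd_mult2)+
    then show ?thesis
      using w unfolding act_reduce
      by (auto simp: act_def ZmodSq_def prod_eq_iff simp flip: mod_eq_dvd_iff)
  qed
  ultimately show ?thesis by (rule that)
qed

text \<open>Simple transitivity: injectivity is uniqueness on a basis, surjectivity is Cramer's
  matrix. Sums over \<open>SL2\<close> thereby become sums over pairs of a fixed
  determinant.\<close>

lemma bij_betw_act_pair:
  assumes x: "x \<in> V" "x' \<in> V" and unit: "\<not> p dvd cross x x'"
  shows "bij_betw (\<lambda>g. (act q g x, act q g x')) SL2
           {w \<in> V \<times> V. cross (fst w) (snd w) mod q = cross x x' mod q}"
proof (rule bij_betwI')
  fix g g' assume "g \<in> SL2" "g' \<in> SL2"
  then show "((act q g x, act q g x') = (act q g' x, act q g' x')) = (g = g')"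
    using act_pair_inj[OF _ _ unit] by (metis prod.inject)
next
  fix g assume "g \<in> SL2"
  then show "(act q g x, act q g x') \<in> {w \<in> V \<times> V. cross (fst w) (snd w) mod q = cross x x' mod q}"
    using x by (simp add: act_V cross_act_SL2)
next
  fix w assume w: "w \<in> {w \<in> V \<times> V. cross (fst w) (snd w) mod q = cross x x' mod q}"
  then have "q dvd cross (fst w) (snd w) - cross x x'"
    by (simp add: mod_eq_dvd_iff)
  then obtain g where "g \<in> SL2" and g: "\<And>z y. y \<in> ZmodSq q \<Longrightarrow>
           q dvd cross x x' * fst y - (cross z x' * fst (fst w) + cross x z * fst (snd w)) \<Longrightarrow>
           q dvd cross x x' * snd y - (cross z x' * snd (fst w) + cross x z * snd (snd w)) \<Longrightarrow> act q g z = y"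
    using exists_transport[OF unit] by metis
  have "act q g x = fst w" "act q g x' = snd w"
    using w by (auto intro!: g simp: V_ZmodSq mem_Times_iff) (simp_all add: cross_def)
  then show "\<exists>g\<in>SL2. w = (act q g x, act q g x')"
    using \<open>g \<in> SL2\<close> by (intro bexI[of _ g]) (simp_all add: prod_eq_iff)
qed

text \<open>Complete \<open>x\<close> to a basis by \<open>x'\<close>. Then \<open>g\<close> is
  determined by the image of \<open>x'\<close>, which lies on the line
  \<open>cross y y' = cross x x'\<close> of at most \<open>q\<close> points.\<close>

lemma card_act_eq_le:
  assumes "x \<in> V" "y \<in> V"
  shows "card {g \<in> SL2. act q g x = y} \<le> nat q"
proof -
  obtain x' where x': "\<not> p dvd cross x x'"
    using primitive_partner[OF V_primitive[OF assms(1)]] by metis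
  have "card {g \<in> SL2. act q g x = y} \<le> card {y' \<in> ZmodSq q. q dvd cross y y' - cross x x'}"
  proof (rule card_inj_on_le[where f = "\<lambda>g. act q g x'"])
    show "inj_on (\<lambda>g. act q g x') {g \<in> SL2. act q g x = y}"
      using act_pair_inj[OF _ _ x'] by (auto intro!: inj_onI simp del: split_paired_All)
    show "(\<lambda>g. act q g x') ` {g \<in> SL2. act q g x = y} \<subseteq> {y' \<in> ZmodSq q. q dvd cross y y' - cross x x'}"
      by (auto simp: act_ZmodSq cross_act_SL2 simp flip: mod_eq_dvd_iff simp del: split_paired_All)
  qed simp
  also have "\<dots> \<le> nat q"
    by (rule card_cross_eq_le) (use assms V_primitive in blast)
  finally show ?thesis .
qed

section \<open>Sizes of the set of primitive vectors and of SL2\<close>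

lemma card_ZmodSq: "card (ZmodSq q) = nat q * nat q"
  by (simp add: ZmodSq_def card_cartesian_product)

lemma card_V_le: "card V \<le> nat q * nat q"
  using card_mono[OF finite_ZmodSq, of V] by (simp add: V_def card_ZmodSq)

lemma card_not_primitive_le: "card {x \<in> ZmodSq q. \<not> primitive p x} \<le> nat r * nat r"
  using card_congruent_le[of "(0, 0)"] by (simp add: primitive_def)

text \<open>The first column is primitive, with at most q^2 choices; the second lies on the line of
  determinant 1, with at most \<open>q\<close>.\<close>

lemma card_SL2_le: "card SL2 \<le> nat q ^ 3"
proof -
  have "SL2 \<subseteq> Sigma V (\<lambda>u. {v \<in> ZmodSq q. q dvd cross u v - 1})"
  proof
    fix g assume "g \<in> SL2"
    then obtain u v where g: "g = (u, v)" "u \<in> ZmodSq q" "v \<in> ZmodSq q" "q dvd cross u v - 1"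
      by (auto simp: SL2_def)
    have "\<not> p dvd cross u v"
    proof
      assume "p dvd cross u v"
      then have "p dvd cross u v - (cross u v - 1)"
        using dvd_trans[OF p_dvd_q g(4)] by (rule dvd_diff)
      then show False using p_gt1 by simp
    qed
    then show "g \<in> Sigma V (\<lambda>u. {v \<in> ZmodSq q. q dvd cross u v - 1})"
      using g primitive_if_cross_unit by (auto simp: V_def)
  qed
  then have "card SL2 \<le> card (Sigma V (\<lambda>u. {v \<in> ZmodSq q. q dvd cross u v - 1}))"
    by (rule card_mono[rotated]) auto
  also have "\<dots> = (\<Sum>u\<in>V. card {v \<in> ZmodSq q. q dvd cross u v - 1})"
    by (rule card_SigmaI) auto
  also have "\<dots> \<le> (\<Sum>u\<in>V. nat q)"
    by (intro sum_mono card_cross_eq_le V_primitive)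
  also have "\<dots> \<le> (nat q * nat q) * nat q"
    using card_V_le by (simp add: mult_right_mono)
  finally show ?thesis by (simp add: power3_eq_cube)
qed

end

section \<open>Variance of the self-correlation\<close>

context prime_power_plane
begin

definition diff :: "int \<times> int \<Rightarrow> int \<times> int \<Rightarrow> int \<times> int" where
  "diff y z = (fst y - fst z, snd y - snd z)"

lemma cross_diff: "cross x (diff y z) = cross x y - cross x z"
  by (simp add: cross_def diff_def algebra_simps)

lemma K_diff_commute: "K (diff y z) = K (diff z y)"
proof -
  have "q dvd cross x (diff y z) \<longleftrightarrow> q dvd cross x (diff z y)" for x
    unfolding cross_diff by (rule dvd_diff_commute)
  then show ?thesis by (simp add: K_def)
qed

text \<open>Euler's totient of \<open>q\<close>, the value of \<open>K\<close> at every primitive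
  vector by \<open>K_primitive\<close>.\<close>

definition K0 :: nat where
  "K0 = card {t \<in> {0..<q}. \<not> p dvd t}"

lemma K0_le: "K0 \<le> nat q"
proof -
  have "K0 \<le> card {0..<q}"
    unfolding K0_def by (rule card_mono) auto
  then show ?thesis by simp
qed

lemma card_not_primitive_diff_le: "card {z \<in> V. \<not> primitive p (diff z y)} \<le> nat r * nat r"
proof -
  have "{z \<in> V. \<not> primitive p (diff z y)}
        \<subseteq> {z \<in> ZmodSq q. p dvd fst z - fst y \<and> p dvd snd z - snd y}"
    by (auto simp: V_def primitive_def diff_def)
  then have "card {z \<in> V. \<not> primitive p (diff z y)}
        \<le> card {z \<in> ZmodSq q. p dvd fst z - fst y \<and> p dvd snd z - snd y}"
    by (rule card_mono[rotated]) simp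
  then show ?thesis using card_congruent_le by (rule order.trans)
qed

text \<open>Double counting: for each \<open>x\<close> in \<open>V\<close>, the points
  \<open>z\<close> on the line through \<open>y\<close> that are also congruent to \<open>y\<close>
  mod \<open>p\<close> number at most \<open>r\<close>.\<close>

lemma sum_K_not_primitive_le:
  "(\<Sum>z\<in>{z \<in> V. \<not> primitive p (diff z y)}. K (diff z y)) \<le> nat q * nat q * nat r"
proof -
  let ?N = "{z \<in> V. \<not> primitive p (diff z y)}"
  have "(\<Sum>z\<in>?N. K (diff z y)) = card (Sigma ?N (\<lambda>z. {x \<in> V. q dvd cross x (diff z y)}))"
    unfolding K_def by (rule card_SigmaI[symmetric]) auto
  also have "\<dots> = card (Sigma V (\<lambda>x. {z \<in> ?N. q dvd cross x (diff z y)}))"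
    by (rule bij_betw_same_card[of prod.swap]) (auto simp: bij_betw_def image_iff inj_on_def)
  also have "\<dots> = (\<Sum>x\<in>V. card {z \<in> ?N. q dvd cross x (diff z y)})"
    by (rule card_SigmaI) auto
  also have "\<dots> \<le> (\<Sum>x\<in>V. nat r)"
  proof (rule sum_mono)
    fix x assume x: "x \<in> V"
    have "{z \<in> ?N. q dvd cross x (diff z y)}
          \<subseteq> {z \<in> ZmodSq q. q dvd cross x z - cross x y \<and> p dvd fst z - fst y \<and> p dvd snd z - snd y}"
      by (auto simp: V_def primitive_def cross_diff) (auto simp: diff_def)
    then have "card {z \<in> ?N. q dvd cross x (diff z y)}
          \<le> card {z \<in> ZmodSq q. q dvd cross x z - cross x y \<and> p dvd fst z - fst y \<and> p dvd snd z - snd y}"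
      by (rule card_mono[rotated]) simp
    also have "\<dots> \<le> nat r"
      by (rule card_cross_eq_congruent_le[OF V_primitive[OF x]])
    finally show "card {z \<in> ?N. q dvd cross x (diff z y)} \<le> nat r" .
  qed
  also have "\<dots> \<le> nat q * nat q * nat r"
    using card_V_le by (simp add: mult_right_mono)
  finally show ?thesis .
qed

lemma r_sq_le: "nat q * (nat r * nat r) \<le> nat q * nat q * nat r"
proof -
  have "nat r \<le> nat q" using r_pos p_gt1 by (intro nat_mono) (simp add: q_eq)
  then show ?thesis by (simp add: mult.assoc mult_left_mono)
qed

text \<open>This is q^3/p, a factor \<open>p\<close> below the bound q^3 for the size of
  \<open>SL2\<close>.\<close>

definition energy_bound :: real where
  "energy_bound = real (nat q * nat q * nat r)"

text \<open>The kernel \<open>K\<close> is constant on primitive vectors and \<open>h\<close> has mean zero, so only the few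
  non-primitive differences contribute.\<close>

lemma kernel_form_le:
  fixes h :: "int \<times> int \<Rightarrow> real"
  assumes mean: "(\<Sum>x\<in>V. h x) = 0"
  shows "(\<Sum>y\<in>V. \<Sum>z\<in>V. h y * h z * real (K (diff z y))) \<le> 2 * energy_bound * (\<Sum>x\<in>V. (h x)\<^sup>2)"
proof -
  define B where "B y z = real (K (diff z y)) - real K0" for y z
  have "(\<Sum>y\<in>V. \<Sum>z\<in>V. h y * h z * real K0) = (\<Sum>y\<in>V. h y * real K0 * (\<Sum>z\<in>V. h z))"
    unfolding sum_distrib_left by (simp add: mult_ac)
  then have "(\<Sum>y\<in>V. \<Sum>z\<in>V. h y * h z * real K0) = 0"
    by (simp add: mean)
  then have "(\<Sum>y\<in>V. \<Sum>z\<in>V. h y * h z * real (K (diff z y))) = (\<Sum>y\<in>V. \<Sum>z\<in>V. h y * h z * B y z)"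
    by (simp add: B_def right_diff_distrib sum_subtractf)
  also have "\<dots> \<le> 2 * energy_bound * (\<Sum>x\<in>V. (h x)\<^sup>2)"
  proof (rule schur_test)
    show "B y z = B z y" for y z
      unfolding B_def by (subst K_diff_commute) (rule refl)
    fix y assume "y \<in> V"
    let ?N = "{z \<in> V. \<not> primitive p (diff z y)}"
    have "(\<Sum>z\<in>V. \<bar>B y z\<bar>) = (\<Sum>z\<in>?N. \<bar>B y z\<bar>)"
      by (rule sum.mono_neutral_right) (auto simp: B_def K0_def K_primitive)
    also have "\<dots> \<le> (\<Sum>z\<in>?N. real (K (diff z y)) + real K0)"
      by (rule sum_mono) (simp add: B_def)
    also have "\<dots> = real ((\<Sum>z\<in>?N. K (diff z y)) + card ?N * K0)"
      by (simp add: sum.distrib)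
    \<comment> \<open>Both summands are at most \<open>energy_bound\<close>, whence the factor
      2.\<close>
    also have "\<dots> \<le> real (nat q * nat q * nat r + nat q * (nat r * nat r))"
    proof -
      have "card ?N * K0 \<le> (nat r * nat r) * nat q"
        by (rule mult_mono[OF card_not_primitive_diff_le K0_le]) auto
      then show ?thesis
        using sum_K_not_primitive_le[of y] by (simp only: of_nat_le_iff mult.commute[of "nat q" "nat r * nat r"] add_mono)
    qed
    also have "\<dots> \<le> real (2 * (nat q * nat q * nat r))"
      using r_sq_le by (simp only: of_nat_le_iff)
    finally show "(\<Sum>z\<in>V. \<bar>B y z\<bar>) \<le> 2 * energy_bound"
      by (simp add: energy_bound_def)
  qed
  finally show ?thesis .
qed

text \<open>Expanding the squares gives a sum over pairs \<open>y\<close>, \<open>z\<close> on a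
  common line; summing over \<open>x\<close> first turns the number of such lines into the kernel
  \<open>K\<close>.\<close>

lemma line_sums_le:
  fixes h :: "int \<times> int \<Rightarrow> real"
  assumes mean: "(\<Sum>x\<in>V. h x) = 0"
  shows "(\<Sum>d\<in>{0..<q}. \<Sum>x\<in>V. (\<Sum>y\<in>{y \<in> V. cross x y mod q = d}. h y)\<^sup>2)
           \<le> 2 * energy_bound * (\<Sum>x\<in>V. (h x)\<^sup>2)"
proof -
  have "(\<Sum>d\<in>{0..<q}. \<Sum>x\<in>V. (\<Sum>y\<in>{y \<in> V. cross x y mod q = d}. h y)\<^sup>2)
        = (\<Sum>x\<in>V. \<Sum>d\<in>{0..<q}. (\<Sum>y\<in>{y \<in> V. cross x y mod q = d}. h y)\<^sup>2)"
    by (rule sum.swap)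
  also have "\<dots> = (\<Sum>x\<in>V. \<Sum>y\<in>V. h y * (\<Sum>z\<in>{z \<in> V. cross x z mod q = cross x y mod q}. h z))"
    by (intro sum.cong refl sum_fibres_squared) (use q_pos in auto)
  also have "\<dots> = (\<Sum>x\<in>V. \<Sum>y\<in>V. \<Sum>z\<in>V. if q dvd cross x (diff z y) then h y * h z else 0)"
    by (simp add: sum.inter_filter sum_distrib_left cross_diff mod_eq_dvd_iff if_distrib cong: if_cong)
  also have "\<dots> = (\<Sum>y\<in>V. \<Sum>z\<in>V. \<Sum>x\<in>V. if q dvd cross x (diff z y) then h y * h z else 0)"
    by (subst sum.swap, rule sum.cong[OF refl], rule sum.swap)
  also have "\<dots> = (\<Sum>y\<in>V. \<Sum>z\<in>V. h y * h z * real (K (diff z y)))"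
    by (simp add: K_def mult.commute flip: sum.inter_filter)
  also have "\<dots> \<le> 2 * energy_bound * (\<Sum>x\<in>V. (h x)\<^sup>2)"
    by (rule kernel_form_le[OF mean])
  finally show ?thesis .
qed

definition act2 where
  "act2 g z = (act q g (fst z), act q g (snd z))"

text \<open>As \<open>g\<close> varies, the image of a pair of unit determinant runs once over all
  pairs of that determinant. So the double sum is the sum over \<open>d\<close> of the squared sum
  of \<open>H\<close> over pairs of determinant \<open>d\<close>, and Cauchy-Schwarz in the first
  point leaves line sums.\<close>

lemma unit_pairs_le:
  fixes h :: "int \<times> int \<Rightarrow> real"
  assumes mean: "(\<Sum>x\<in>V. h x) = 0"
  defines "H \<equiv> \<lambda>z. h (fst z) * h (snd z)"
    and "U \<equiv> {z \<in> V \<times> V. \<not> p dvd cross (fst z) (snd z)}"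
  shows "(\<Sum>g\<in>SL2. \<Sum>z\<in>U. H z * H (act2 g z)) \<le> 2 * energy_bound * (\<Sum>x\<in>V. (h x)\<^sup>2)\<^sup>2"
proof -
  let ?\<phi> = "\<lambda>z. cross (fst z) (snd z) mod q"
  let ?L = "\<lambda>x d. \<Sum>y\<in>{y \<in> V. cross x y mod q = d}. h y"
  let ?N = "\<Sum>x\<in>V. (h x)\<^sup>2"
  have [simp]: "finite U" by (simp add: U_def)
  have "(\<Sum>g\<in>SL2. \<Sum>z\<in>U. H z * H (act2 g z)) = (\<Sum>z\<in>U. H z * (\<Sum>g\<in>SL2. H (act2 g z)))"
    by (subst sum.swap) (simp add: sum_distrib_left)
  also have "\<dots> = (\<Sum>z\<in>U. H z * (\<Sum>w\<in>{w \<in> U. ?\<phi> w = ?\<phi> z}. H w))"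
  proof (rule sum.cong[OF refl])
    fix z assume z: "z \<in> U"
    have "(\<Sum>g\<in>SL2. H (act2 g z)) = (\<Sum>w\<in>{w \<in> V \<times> V. ?\<phi> w = ?\<phi> z}. H w)"
      unfolding act2_def
      by (rule sum.reindex_bij_betw, rule bij_betw_act_pair) (use z in \<open>auto simp: U_def\<close>)
    also have "{w \<in> V \<times> V. ?\<phi> w = ?\<phi> z} = {w \<in> U. ?\<phi> w = ?\<phi> z}"
      using z unfolding U_def by (auto simp del: split_paired_All) (metis dvd_mod_q_iff)
    finally show "H z * (\<Sum>g\<in>SL2. H (act2 g z)) = H z * (\<Sum>w\<in>{w \<in> U. ?\<phi> w = ?\<phi> z}. H w)"
      by simp
  qed
  also have "\<dots> = (\<Sum>d\<in>{0..<q}. (\<Sum>z\<in>{z \<in> U. ?\<phi> z = d}. H z)\<^sup>2)"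
    by (rule sum_fibres_squared[symmetric]) (use q_pos in auto)
  also have "\<dots> \<le> (\<Sum>d\<in>{0..<q}. ?N * (\<Sum>x\<in>V. (?L x d)\<^sup>2))"
  proof (rule sum_mono)
    fix d
    show "(\<Sum>z\<in>{z \<in> U. ?\<phi> z = d}. H z)\<^sup>2 \<le> ?N * (\<Sum>x\<in>V. (?L x d)\<^sup>2)"
    proof (cases "p dvd d")
      case True
      \<comment> \<open>Pairs in \<open>U\<close> have unit determinant, so the left side is
        0.\<close>
      then have "{z \<in> U. ?\<phi> z = d} = {}"
        by (auto simp: U_def dvd_mod_q_iff)
      then show ?thesis
        by (simp add: sum_nonneg del: Collect_empty_eq)
    next
      case False
      then have "{z \<in> U. ?\<phi> z = d} = Sigma V (\<lambda>x. {y \<in> V. cross x y mod q = d})"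
        by (auto simp: U_def dvd_mod_q_iff)
      then have "(\<Sum>z\<in>{z \<in> U. ?\<phi> z = d}. H z) = (\<Sum>x\<in>V. \<Sum>y\<in>{y \<in> V. cross x y mod q = d}. h x * h y)"
        by (simp add: H_def sum.Sigma case_prod_beta)
      also have "\<dots> = (\<Sum>x\<in>V. h x * ?L x d)"
        by (simp add: sum_distrib_left)
      finally show ?thesis
        using Cauchy_Schwarz_ineq_sum[of h "\<lambda>x. ?L x d" V] by simp
    qed
  qed
  also have "\<dots> = ?N * (\<Sum>d\<in>{0..<q}. \<Sum>x\<in>V. (?L x d)\<^sup>2)"
    by (simp add: sum_distrib_left)
  also have "\<dots> \<le> ?N * (2 * energy_bound * ?N)"
    by (intro mult_left_mono line_sums_le mean sum_nonneg) auto
  finally show ?thesis by (simp add: power2_eq_square mult_ac)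
qed

text \<open>Each \<open>y\<close> is the image of \<open>x\<close> under at most \<open>q\<close>
  matrices.\<close>

lemma sum_act_squared_le:
  fixes h :: "int \<times> int \<Rightarrow> real"
  assumes "x \<in> V"
  shows "(\<Sum>g\<in>SL2. (h (act q g x))\<^sup>2) \<le> real (nat q) * (\<Sum>y\<in>V. (h y)\<^sup>2)"
proof -
  have "(\<Sum>g\<in>SL2. (h (act q g x))\<^sup>2) = (\<Sum>y\<in>V. \<Sum>g\<in>{g \<in> SL2. act q g x = y}. (h (act q g x))\<^sup>2)"
    by (rule sum.group[symmetric]) (auto simp: assms act_V)
  also have "\<dots> = (\<Sum>y\<in>V. real (card {g \<in> SL2. act q g x = y}) * (h y)\<^sup>2)"
    by (intro sum.cong refl) simp
  also have "\<dots> \<le> (\<Sum>y\<in>V. real (nat q) * (h y)\<^sup>2)"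
    by (intro sum_mono mult_right_mono) (use assms card_act_eq_le in auto)
  finally show ?thesis by (simp add: sum_distrib_left)
qed

text \<open>No cancellation is used: the product is at most the mean of \<open>?F\<close> at the
  pair and at the swapped pair, and \<open>W\<close> is symmetric. The sum over \<open>g\<close>
  costs a factor \<open>q\<close>, and each \<open>x\<close> has at most \<open>q r\<close> partners
  in \<open>W\<close>.\<close>

lemma nonunit_pairs_le:
  fixes h :: "int \<times> int \<Rightarrow> real"
  defines "H \<equiv> \<lambda>z. h (fst z) * h (snd z)"
    and "W \<equiv> {z \<in> V \<times> V. p dvd cross (fst z) (snd z)}"
  shows "(\<Sum>g\<in>SL2. \<Sum>z\<in>W. H z * H (act2 g z)) \<le> energy_bound * (\<Sum>x\<in>V. (h x)\<^sup>2)\<^sup>2"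
proof -
  define N where "N = (\<Sum>x\<in>V. (h x)\<^sup>2)"
  let ?F = "\<lambda>g z. (h (fst z))\<^sup>2 * (h (act q g (snd z)))\<^sup>2"
  have [simp]: "finite W" by (simp add: W_def)
  have swap: "(\<Sum>z\<in>W. ?F g (prod.swap z)) = (\<Sum>z\<in>W. ?F g z)" for g
  proof (rule sum.reindex_bij_betw)
    have "p dvd cross y x" if "p dvd cross x y" for x y
    proof -
      have "cross y x = - cross x y" by (simp add: cross_def)
      then show ?thesis using that by simp
    qed
    then show "bij_betw prod.swap W W"
      by (intro bij_betw_byWitness[where f' = prod.swap]) (auto simp: W_def)
  qed
  have "H z * H (act2 g z) \<le> (?F g z + ?F g (prod.swap z)) / 2" for g z
    using sum_squares_bound[of "h (fst z) * h (act q g (snd z))" "h (snd z) * h (act q g (fst z))"]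
    by (simp add: H_def act2_def power_mult_distrib mult_ac)
  then have "(\<Sum>g\<in>SL2. \<Sum>z\<in>W. H z * H (act2 g z)) \<le> (\<Sum>g\<in>SL2. \<Sum>z\<in>W. (?F g z + ?F g (prod.swap z)) / 2)"
    by (intro sum_mono)
  also have "\<dots> = (\<Sum>g\<in>SL2. ((\<Sum>z\<in>W. ?F g z) + (\<Sum>z\<in>W. ?F g (prod.swap z))) / 2)"
    by (simp only: sum.distrib flip: sum_divide_distrib)
  also have "\<dots> = (\<Sum>z\<in>W. (h (fst z))\<^sup>2 * (\<Sum>g\<in>SL2. (h (act q g (snd z)))\<^sup>2))"
    unfolding swap sum_distrib_left by (subst sum.swap) simp
  also have "\<dots> \<le> (\<Sum>z\<in>W. (h (fst z))\<^sup>2 * (real (nat q) * N))"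
    unfolding N_def by (intro sum_mono mult_left_mono sum_act_squared_le) (auto simp: W_def)
  also have "\<dots> = real (nat q) * N * (\<Sum>z\<in>W. (h (fst z))\<^sup>2)"
    by (simp add: sum_distrib_left mult_ac)
  also have "(\<Sum>z\<in>W. (h (fst z))\<^sup>2) = (\<Sum>x\<in>V. real (card {y \<in> V. p dvd cross x y}) * (h x)\<^sup>2)"
  proof -
    have "W = Sigma V (\<lambda>x. {y \<in> V. p dvd cross x y})"
      by (auto simp: W_def)
    then show ?thesis
      using sum.Sigma[of V "\<lambda>x. {y \<in> V. p dvd cross x y}" "\<lambda>x y. (h x)\<^sup>2"]
      by (simp add: case_prod_beta)
  qed
  also have "real (nat q) * N * \<dots> \<le> real (nat q) * N * (\<Sum>x\<in>V. real (nat q * nat r) * (h x)\<^sup>2)"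
  proof (intro mult_left_mono sum_mono mult_right_mono)
    fix x assume x: "x \<in> V"
    have "card {y \<in> V. p dvd cross x y} \<le> card {y \<in> ZmodSq q. p dvd cross x y}"
      by (rule card_mono) (auto simp: V_def)
    also have "\<dots> \<le> nat q * nat r"
      by (rule card_cross_dvd_le[OF V_primitive[OF x]])
    finally show "real (card {y \<in> V. p dvd cross x y}) \<le> real (nat q * nat r)"
      by (simp only: of_nat_le_iff)
  qed (auto intro!: mult_nonneg_nonneg sum_nonneg simp: N_def)
  also have "\<dots> = energy_bound * N\<^sup>2"
    unfolding N_def sum_distrib_left[symmetric]
    by (simp add: energy_bound_def power2_eq_square mult_ac)
  finally show ?thesis by (simp only: N_def)
qed

lemma correlation_variance_le:
  fixes h :: "int \<times> int \<Rightarrow> real"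
  assumes mean: "(\<Sum>x\<in>V. h x) = 0"
  shows "(\<Sum>g\<in>SL2. (\<Sum>x\<in>V. h x * h (act q g x))\<^sup>2) \<le> 3 * energy_bound * (\<Sum>x\<in>V. (h x)\<^sup>2)\<^sup>2"
proof -
  define H where "H z = h (fst z) * h (snd z)" for z
  let ?U = "{z \<in> V \<times> V. \<not> p dvd cross (fst z) (snd z)}" and ?W = "{z \<in> V \<times> V. p dvd cross (fst z) (snd z)}"
  have "(\<Sum>x\<in>V. h x * h (act q g x))\<^sup>2 = (\<Sum>z\<in>?U. H z * H (act2 g z)) + (\<Sum>z\<in>?W. H z * H (act2 g z))" for g
  proof -
    have "(\<Sum>x\<in>V. h x * h (act q g x))\<^sup>2 = (\<Sum>z\<in>V \<times> V. H z * H (act2 g z))"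
      by (simp add: power2_eq_square sum_product sum.cartesian_product H_def act2_def case_prod_beta mult_ac)
    also have "V \<times> V = ?U \<union> ?W" by auto
    also have "(\<Sum>z\<in>?U \<union> ?W. H z * H (act2 g z)) = (\<Sum>z\<in>?U. H z * H (act2 g z)) + (\<Sum>z\<in>?W. H z * H (act2 g z))"
      by (rule sum.union_disjoint) auto
    finally show ?thesis .
  qed
  then show ?thesis
    using unit_pairs_le[OF mean] nonunit_pairs_le[of h]
    by (simp add: sum.distrib H_def)
qed

end

section \<open>Moments and counting of classes\<close>

text \<open>\<open>f\<close> is at most twice the larger of \<open>m\<close> and |f - m|. Since |f -
  m| is at most \<open>e\<close>, all but two factors of its power can be replaced by
  \<open>e\<close>; this turns a variance bound into a moment bound.\<close>

lemma power_le_split: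
  fixes f m e :: real
  assumes "0 \<le> f" "f \<le> e" "0 \<le> m" "m \<le> e" "n \<ge> 2"
  shows "f ^ n \<le> 2 ^ n * (m ^ n + e ^ (n - 2) * (f - m)\<^sup>2)"
proof -
  define a where "a = \<bar>f - m\<bar>"
  have a2: "a\<^sup>2 = (f - m)\<^sup>2" and a0: "0 \<le> a" "a \<le> e" "f \<le> m + a"
    using assms by (auto simp: a_def)
  have "a ^ n = a ^ (n - 2) * a\<^sup>2"
    using assms(5) by (metis power_add le_add_diff_inverse2)
  also have "\<dots> \<le> e ^ (n - 2) * (f - m)\<^sup>2"
    unfolding a2 using a0 by (intro mult_right_mono power_mono) auto
  finally have an: "a ^ n \<le> e ^ (n - 2) * (f - m)\<^sup>2" .
  have "f \<le> 2 * max m a" using a0 by (simp add: max_def)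
  then have "f ^ n \<le> (2 * max m a) ^ n"
    using assms by (intro power_mono)
  also have "\<dots> = 2 ^ n * max m a ^ n"
    by (rule power_mult_distrib)
  also have "max m a ^ n \<le> m ^ n + a ^ n"
    using assms a0 by (auto simp: max_def)
  finally show ?thesis
    using an by (auto intro: order.trans mult_left_mono)
qed

lemma card_Cconf_mono:
  assumes "finite E" "E' \<subseteq> E"
  shows "card (Cconf q E' k) \<le> card (Cconf q E k)"
proof -
  have "configs E' k \<subseteq> configs E k" using assms by (auto simp: configs_def)
  moreover have "finite (configs E k)"
    unfolding configs_def using finite_lists_length_eq[OF assms(1), of "k + 1"]
    by (simp add: conj_commute)
  ultimately show ?thesis
    unfolding card_Cconf by (intro card_mono image_mono) auto
qed

context prime_power_plane
begin

definition stay :: "(int \<times> int) set \<Rightarrow> (int \<times> int) \<times> (int \<times> int) \<Rightarrow> (int \<times> int) set" where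
  "stay E g = {x \<in> E. act q g x \<in> E}"

lemma card_stay_le: "finite E \<Longrightarrow> card (stay E g) \<le> card E"
  by (auto simp: stay_def intro: card_mono)

lemma card_ZmodSq_split: "card (ZmodSq q) = card V + card {x \<in> ZmodSq q. \<not> primitive p x}"
  unfolding V_def by (subst card_Un_disjoint[symmetric]) (auto intro: arg_cong[of _ _ card])

lemma card_V_ge: "(real_of_int q)\<^sup>2 / 2 \<le> real (card V)"
proof -
  have "2 * r \<le> q" using p_gt1 r_pos by (simp add: q_eq)
  then have r2: "2 * nat r \<le> nat q" by simp
  have "2 * (nat r * nat r) \<le> nat q * nat q"
    using mult_mono[OF r2 r2] by simp
  then have "nat q * nat q \<le> 2 * card V"
    using card_ZmodSq_split card_not_primitive_le unfolding card_ZmodSq by linarith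
  then have "real (nat q * nat q) \<le> real (2 * card V)"
    by (simp only: of_nat_le_iff)
  then show ?thesis using q_pos by (simp add: power2_eq_square)
qed

lemma card_V_pos: "card V > 0"
  using card_V_ge q_pos by (metis divide_pos_pos less_le_trans of_nat_0_less_iff of_int_0_less_iff zero_less_numeral zero_less_power)

text \<open>Take \<open>h\<close> to be the indicator of \<open>E\<close> minus its density
  \<open>b\<close> in \<open>V\<close>. As \<open>g\<close> permutes \<open>V\<close>, the shifted
  indicator has the same sum, and the correlation of \<open>h\<close> with its shift is exactly the
  deviation of \<open>card (stay E g)\<close>.\<close>

lemma card_stay_variance_le:
  assumes E: "E \<subseteq> V"
  shows "(\<Sum>g\<in>SL2. (real (card (stay E g)) - (real (card E))\<^sup>2 / real (card V))\<^sup>2)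
           \<le> 3 * energy_bound * (real (card E))\<^sup>2"
proof -
  define b where "b = real (card E) / real (card V)"
  define ind where "ind x = (if x \<in> E then 1 else 0 :: real)" for x
  define h where "h x = ind x - b" for x
  have bV: "b * real (card V) = real (card E)"
  proof -
    have "real (card V) \<noteq> 0" using card_V_pos by linarith
    then show ?thesis
      by (metis b_def eq_divide_eq)
  qed
  have EV: "V \<inter> E = E" using E by auto
  have ind: "(\<Sum>x\<in>V. ind x) = real (card E)"
    by (simp add: ind_def EV flip: sum.inter_restrict)
  have mean: "(\<Sum>x\<in>V. h x) = 0"
    by (simp add: h_def sum_subtractf ind bV mult.commute)
  have "(\<Sum>x\<in>V. (h x)\<^sup>2) = (\<Sum>x\<in>V. (1 - 2 * b) * ind x + b\<^sup>2)"
    by (intro sum.cong refl) (simp add: h_def ind_def power2_eq_square algebra_simps)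
  also have "\<dots> = (1 - 2 * b) * real (card E) + b * (b * real (card V))"
    by (simp add: sum.distrib ind power2_eq_square flip: sum_distrib_left)
  also have "\<dots> = real (card E) - b * real (card E)"
    unfolding bV by (simp add: algebra_simps)
  also have "\<dots> \<le> real (card E)"
    by (simp add: b_def)
  finally have norm: "(\<Sum>x\<in>V. (h x)\<^sup>2) \<le> real (card E)" .
  have "(\<Sum>x\<in>V. h x * h (act q g x)) = real (card (stay E g)) - (real (card E))\<^sup>2 / real (card V)"
    if g: "g \<in> SL2" for g
  proof -
    have "(\<Sum>x\<in>V. ind (act q g x)) = (\<Sum>x\<in>V. ind x)"
      by (rule sum.reindex_bij_betw[OF bij_betw_act[OF g]])
    then have shifted: "(\<Sum>x\<in>V. ind (act q g x)) = real (card E)"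
      by (simp add: ind)
    have "V \<inter> stay E g = stay E g" using E by (auto simp: stay_def)
    then have "(\<Sum>x\<in>V. if x \<in> stay E g then 1 else 0 :: real) = real (card (stay E g))"
      by (simp flip: sum.inter_restrict)
    moreover have "ind x * ind (act q g x) = (if x \<in> stay E g then 1 else 0)" for x
      by (simp add: ind_def stay_def)
    ultimately have both: "(\<Sum>x\<in>V. ind x * ind (act q g x)) = real (card (stay E g))"
      by simp
    have "(\<Sum>x\<in>V. h x * h (act q g x))
        = (\<Sum>x\<in>V. ind x * ind (act q g x) - b * ind x - b * ind (act q g x) + b * b)"
      by (intro sum.cong refl) (simp add: h_def algebra_simps)
    also have "\<dots> = real (card (stay E g)) - b * real (card E) - b * real (card E) + b * (b * real (card V))"
      by (simp add: sum.distrib sum_subtractf both ind shifted flip: sum_distrib_left)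
    also have "\<dots> = real (card (stay E g)) - b * real (card E)"
      unfolding bV by simp
    finally show ?thesis by (simp add: b_def power2_eq_square)
  qed
  then have "(\<Sum>g\<in>SL2. (real (card (stay E g)) - (real (card E))\<^sup>2 / real (card V))\<^sup>2)
      = (\<Sum>g\<in>SL2. (\<Sum>x\<in>V. h x * h (act q g x))\<^sup>2)"
    by simp
  also have "\<dots> \<le> 3 * energy_bound * (\<Sum>x\<in>V. (h x)\<^sup>2)\<^sup>2"
    by (rule correlation_variance_le[OF mean])
  also have "\<dots> \<le> 3 * energy_bound * (real (card E))\<^sup>2"
    by (intro mult_left_mono power_mono norm sum_nonneg) (auto simp: energy_bound_def)
  finally show ?thesis .
qed

lemma card_stay_moment_le:
  assumes E: "E \<subseteq> V" and n: "n \<ge> 2"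
  defines "e \<equiv> real (card E)" and "m \<equiv> (real (card E))\<^sup>2 / real (card V)"
  shows "(\<Sum>g\<in>SL2. real (card (stay E g)) ^ n) \<le> 2 ^ n * (real (card SL2) * m ^ n + 3 * energy_bound * e ^ n)"
proof -
  have fin: "finite E" using E finite_subset finite_V by blast
  have "card E \<le> card V" using E by (intro card_mono) auto
  then have "m \<le> e"
    using card_V_pos by (simp add: m_def e_def power2_eq_square field_simps mult_left_mono)
  have "(\<Sum>g\<in>SL2. real (card (stay E g)) ^ n)
      \<le> (\<Sum>g\<in>SL2. 2 ^ n * (m ^ n + e ^ (n - 2) * (real (card (stay E g)) - m)\<^sup>2))"
    by (intro sum_mono power_le_split n \<open>m \<le> e\<close>) (auto simp: m_def e_def card_stay_le[OF fin])
  also have "\<dots> = 2 ^ n * (real (card SL2) * m ^ n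
      + e ^ (n - 2) * (\<Sum>g\<in>SL2. (real (card (stay E g)) - m)\<^sup>2))"
    by (simp add: sum.distrib flip: sum_distrib_left)
  also have "\<dots> \<le> 2 ^ n * (real (card SL2) * m ^ n + e ^ (n - 2) * (3 * energy_bound * e\<^sup>2))"
    unfolding e_def m_def
    by (intro mult_left_mono add_left_mono card_stay_variance_le E) auto
  also have "e ^ (n - 2) * (3 * energy_bound * e\<^sup>2) = 3 * energy_bound * (e ^ (n - 2) * e\<^sup>2)"
    by (simp only: mult_ac)
  also have "e ^ (n - 2) * e\<^sup>2 = e ^ n"
    using n by (metis power_add le_add_diff_inverse2)
  finally show ?thesis .
qed

text \<open>Asking the first two points to form a basis makes equivalent configurations images of
  each other under \<open>SL2\<close>; for large \<open>E\<close> at least half of all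
  configurations remain.\<close>

definition unit_configs :: "(int \<times> int) set \<Rightarrow> nat \<Rightarrow> (int \<times> int) list set" where
  "unit_configs E k = {xs \<in> configs E k. \<not> p dvd cross (xs ! 0) (xs ! 1)}"

text \<open>Choose \<open>g\<close> on the basis formed by the first two points. The determinants of
  a further point against these two are its coordinates up to the common unit, so \<open>g\<close>
  carries it along.\<close>

lemma transport_config:
  assumes xs: "xs \<in> unit_configs E k" and ys: "ys \<in> configs V k" and k: "k \<ge> 1"
    and eq: "det_matrix q k ((!) ys) = det_matrix q k ((!) xs)"
  obtains g where "g \<in> SL2" "ys = map (act q g) xs"
proof -
  have len: "length xs = k + 1" "length ys = k + 1"
    using xs ys by (auto simp: unit_configs_def configs_def)
  have cong: "q dvd cross (ys ! i) (ys ! j) - cross (xs ! i) (xs ! j)" if "i \<le> k" "j \<le> k" for i j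
    using eq that by (simp add: det_matrix_eq_iff mod_eq_dvd_iff)
  let ?x = "xs ! 0" and ?x' = "xs ! 1" and ?y = "ys ! 0" and ?y' = "ys ! 1"
  have unit: "\<not> p dvd cross ?x ?x'"
    using xs by (simp add: unit_configs_def)
  obtain g where g: "g \<in> SL2" and transport: "\<And>z w. w \<in> ZmodSq q \<Longrightarrow>
           q dvd cross ?x ?x' * fst w - (cross z ?x' * fst ?y + cross ?x z * fst ?y') \<Longrightarrow>
           q dvd cross ?x ?x' * snd w - (cross z ?x' * snd ?y + cross ?x z * snd ?y') \<Longrightarrow> act q g z = w"
  proof -
    have "q dvd cross ?y ?y' - cross ?x ?x'" using cong[of 0 1] k by simp
    from exists_transport[OF unit this] that show ?thesis by metis
  qed
  have "act q g (xs ! i) = ys ! i" if i: "i \<le> k" for i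
  proof (rule transport)
    have "ys ! i \<in> set ys" using i len by simp
    then show "ys ! i \<in> ZmodSq q" using ys by (auto simp: configs_def V_def)
    let ?A = "cross ?y ?y' - cross ?x ?x'" and ?B = "cross (ys ! i) ?y' - cross (xs ! i) ?x'"
      and ?C = "cross ?y (ys ! i) - cross ?x (xs ! i)"
    have dvd: "q dvd ?A" "q dvd ?B" "q dvd ?C"
      using cong i k by auto
    \<comment> \<open>Cramer's relation for \<open>?y\<close>, \<open>?y'\<close> and
      \<open>ys ! i\<close> holds exactly; only the differences \<open>?A\<close>,
      \<open>?B\<close>, \<open>?C\<close> of determinants remain.\<close>
    have "cross ?x ?x' * fst (ys ! i) - (cross (xs ! i) ?x' * fst ?y + cross ?x (xs ! i) * fst ?y')
        = ?B * fst ?y + ?C * fst ?y' - ?A * fst (ys ! i)"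
      "cross ?x ?x' * snd (ys ! i) - (cross (xs ! i) ?x' * snd ?y + cross ?x (xs ! i) * snd ?y')
        = ?B * snd ?y + ?C * snd ?y' - ?A * snd (ys ! i)"
      by (simp_all add: cross_def algebra_simps)
    then show
      "q dvd cross ?x ?x' * fst (ys ! i) - (cross (xs ! i) ?x' * fst ?y + cross ?x (xs ! i) * fst ?y')"
      "q dvd cross ?x ?x' * snd (ys ! i) - (cross (xs ! i) ?x' * snd ?y + cross ?x (xs ! i) * snd ?y')"
      using dvd by (metis dvd_add dvd_diff dvd_mult2)+
  qed
  then have "ys = map (act q g) xs"
    using len by (intro nth_equalityI) auto
  with g show ?thesis by (rule that)
qed

text \<open>An equivalent pair is \<open>xs\<close> together with its image under some
  \<open>g\<close>, and then every point of \<open>xs\<close> lies in \<open>stay E g\<close>; a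
  union bound over \<open>g\<close> finishes.\<close>

lemma card_equivalent_pairs_le:
  assumes E: "E \<subseteq> V" and k: "k \<ge> 1"
  shows "card {(xs, ys). xs \<in> unit_configs E k \<and> ys \<in> unit_configs E k \<and>
                 det_matrix q k ((!) ys) = det_matrix q k ((!) xs)}
           \<le> (\<Sum>g\<in>SL2. card (stay E g) ^ (k + 1))" (is "card ?P \<le> _")
proof -
  have fin: "finite E" using E finite_subset finite_V by blast
  let ?L = "\<lambda>g. {xs. set xs \<subseteq> stay E g \<and> length xs = k + 1}"
  have finL: "finite (?L g)" for g
    by (rule finite_lists_length_eq) (simp add: stay_def fin)
  have "?P \<subseteq> (\<Union>g\<in>SL2. (\<lambda>xs. (xs, map (act q g) xs)) ` ?L g)"
  proof (rule subsetI, clarify)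
    fix xs ys assume *: "xs \<in> unit_configs E k" "ys \<in> unit_configs E k"
      "det_matrix q k ((!) ys) = det_matrix q k ((!) xs)"
    then have "ys \<in> configs V k" using E by (auto simp: unit_configs_def configs_def)
    then obtain g where g: "g \<in> SL2" "ys = map (act q g) xs"
      using transport_config[OF *(1) _ k *(3)] by metis
    have "xs \<in> ?L g"
      using * by (auto simp: g(2) unit_configs_def configs_def stay_def)
    then show "(xs, ys) \<in> (\<Union>g\<in>SL2. (\<lambda>xs. (xs, map (act q g) xs)) ` ?L g)"
      using g by blast
  qed
  then have "card ?P \<le> card (\<Union>g\<in>SL2. (\<lambda>xs. (xs, map (act q g) xs)) ` ?L g)"
    by (rule card_mono[rotated]) (use finL in auto)
  also have "\<dots> \<le> (\<Sum>g\<in>SL2. card ((\<lambda>xs. (xs, map (act q g) xs)) ` ?L g))"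
    by (rule card_UN_le) simp
  also have "\<dots> \<le> (\<Sum>g\<in>SL2. card (stay E g) ^ (k + 1))"
  proof (rule sum_mono)
    fix g
    have "card ((\<lambda>xs. (xs, map (act q g) xs)) ` ?L g) \<le> card (?L g)"
      by (rule card_image_le[OF finL])
    also have "\<dots> = card (stay E g) ^ (k + 1)"
      by (rule card_lists_length_eq) (simp add: stay_def fin)
    finally show "card ((\<lambda>xs. (xs, map (act q g) xs)) ` ?L g) \<le> card (stay E g) ^ (k + 1)" .
  qed
  finally show ?thesis .
qed

text \<open>Each point has at most \<open>q r\<close> partners of non-unit determinant, so at most
  half of the pairs in \<open>E\<close> are bad; the other \<open>k - 1\<close> points are
  free.\<close>

lemma card_unit_configs_ge:
  assumes E: "E \<subseteq> V" and k: "k \<ge> 1" and large: "2 * (nat q * nat r) \<le> card E"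
  shows "card E ^ (k + 1) \<le> 2 * card (unit_configs E k)"
proof -
  have fin: "finite E" using E finite_subset finite_V by blast
  let ?U = "{z \<in> E \<times> E. \<not> p dvd cross (fst z) (snd z)}"
  let ?W = "Sigma E (\<lambda>x. {y \<in> E. p dvd cross x y})"
  let ?L = "{xs. set xs \<subseteq> E \<and> length xs = k - 1}"
  have "card ?W = (\<Sum>x\<in>E. card {y \<in> E. p dvd cross x y})"
    using fin by (intro card_SigmaI) auto
  also have "\<dots> \<le> (\<Sum>x\<in>E. nat q * nat r)"
  proof (rule sum_mono)
    fix x assume "x \<in> E"
    then have x: "primitive p x" using E V_primitive by blast
    have "card {y \<in> E. p dvd cross x y} \<le> card {y \<in> ZmodSq q. p dvd cross x y}"
      using E by (intro card_mono) (auto simp: V_def)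
    also have "\<dots> \<le> nat q * nat r" by (rule card_cross_dvd_le[OF x])
    finally show "card {y \<in> E. p dvd cross x y} \<le> nat q * nat r" .
  qed
  also have "\<dots> = card E * (nat q * nat r)" by simp
  finally have W: "2 * card ?W \<le> card E * card E"
    using mult_le_mono2[OF large, of "card E"] by linarith
  have "E \<times> E = ?U \<union> ?W" by auto
  then have "card (E \<times> E) = card (?U \<union> ?W)" by simp
  also have "\<dots> \<le> card ?U + card ?W" by (rule card_Un_le)
  finally have "card E * card E \<le> card ?U + card ?W"
    by (simp add: card_cartesian_product)
  then have U: "card E * card E \<le> 2 * card ?U" using W by linarith
  have "card ?U * card E ^ (k - 1) = card (?U \<times> ?L)"
    using fin by (simp add: card_cartesian_product card_lists_length_eq)
  also have "\<dots> \<le> card (unit_configs E k)"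
  proof (rule card_inj_on_le[where f = "\<lambda>(z, xs). fst z # snd z # xs"])
    show "inj_on (\<lambda>(z, xs). fst z # snd z # xs) (?U \<times> ?L)"
      by (auto simp: inj_on_def prod_eq_iff)
    show "(\<lambda>(z, xs). fst z # snd z # xs) ` (?U \<times> ?L) \<subseteq> unit_configs E k"
      using k by (auto simp: unit_configs_def configs_def)
    show "finite (unit_configs E k)"
      by (rule finite_subset[OF _ finite_lists_length_eq[OF fin, of "k + 1"]])
        (auto simp: unit_configs_def configs_def)
  qed
  finally have "2 * (card ?U * card E ^ (k - 1)) \<le> 2 * card (unit_configs E k)" by simp
  moreover have "(card E * card E) * card E ^ (k - 1) \<le> (2 * card ?U) * card E ^ (k - 1)"
    by (rule mult_right_mono[OF U]) simp
  moreover have "card E ^ (k + 1) = (card E * card E) * card E ^ (k - 1)"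
    using k by (cases k) auto
  ultimately show ?thesis by linarith
qed

text \<open>The number of classes is at least |G|^2/|P|, with |G| at least half of e^n and |P| at
  most of order Q^3 (e/Q)^(2n). Here \<open>large\<close> controls \<open>G\<close> and
  \<open>dense\<close> controls \<open>P\<close>.\<close>

lemma card_Cconf_ge:
  assumes E: "E \<subseteq> V" and k: "k \<ge> 1" and large: "2 * (nat q * nat r) \<le> card E"
    and dense: "(real_of_int q) ^ (2 * (k + 1)) \<le> real_of_int p * real (card E) ^ (k + 1)"
  shows "(real_of_int q) ^ (2 * k - 1)
           \<le> 4 * 2 ^ (k + 1) * (2 ^ (k + 1) + 3) * real (card (Cconf q E k))"
proof -
  define n where "n = k + 1"
  define e where "e = real (card E)"
  define Q where "Q = real_of_int q"
  define N where "N = real (card (Cconf q E k))"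
  define A :: real where "A = 2 ^ n * (2 ^ n + 3)"
  define G where "G = unit_configs E k"
  define P where "P = {(xs, ys). xs \<in> G \<and> ys \<in> G \<and> det_matrix q k ((!) ys) = det_matrix q k ((!) xs)}"
  have fin: "finite E" using E finite_subset finite_V by blast
  have Q: "Q > 0" using q_pos by (simp add: Q_def)
  have "nat q * nat r > 0" using q_pos r_pos by simp
  then have "card E > 0" using large by linarith
  then have e: "e > 0" by (simp only: e_def of_nat_0_less_iff)
  have p0: "real_of_int p > 0" using p_gt1 by simp
  have energy: "energy_bound = Q ^ 3 / real_of_int p"
  proof -
    have "Q = real_of_int r * real_of_int p"
      unfolding Q_def by (simp only: q_eq of_int_mult)
    then have "real_of_int r = Q / real_of_int p" using p0 by simp
    then show ?thesis
      using q_pos r_pos by (simp add: energy_bound_def Q_def power3_eq_cube)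
  qed
  have "card G * card G \<le> card (Cconf q E k) * card P"
  proof -
    have finG: "finite (configs E k)"
      unfolding configs_def using finite_lists_length_eq[OF fin, of "k + 1"] by (simp add: conj_commute)
    then have "finite G" by (simp add: G_def unit_configs_def)
    then have "(card G)\<^sup>2 \<le> card ((\<lambda>xs. det_matrix q k ((!) xs)) ` G) * card P"
      unfolding P_def by (rule card_squared_le_card_image)
    also have "\<dots> \<le> card (Cconf q E k) * card P"
      unfolding card_Cconf using finG
      by (intro mult_right_mono card_mono) (auto simp: G_def unit_configs_def)
    finally show ?thesis by (simp add: power2_eq_square)
  qed
  then have "real (card G * card G) \<le> real (card (Cconf q E k) * card P)"
    by (simp only: of_nat_le_iff)
  then have cs: "real (card G) * real (card G) \<le> N * real (card P)"
    by (simp add: N_def)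
  have "real (card P) \<le> real (\<Sum>g\<in>SL2. card (stay E g) ^ n)"
    unfolding P_def G_def n_def of_nat_le_iff by (rule card_equivalent_pairs_le[OF E k])
  also have "\<dots> = (\<Sum>g\<in>SL2. real (card (stay E g)) ^ n)"
    by simp
  also have "\<dots> \<le> 2 ^ n * (real (card SL2) * (e\<^sup>2 / real (card V)) ^ n + 3 * energy_bound * e ^ n)"
    unfolding e_def by (rule card_stay_moment_le[OF E]) (use k in \<open>simp add: n_def\<close>)
  also have "\<dots> \<le> 2 ^ n * (Q ^ 3 * (2 ^ n * (e ^ (2 * n) / Q ^ (2 * n))) + 3 * (Q ^ 3 * (e ^ (2 * n) / Q ^ (2 * n))))"
  proof (intro mult_left_mono add_mono)
    have "real (card SL2) \<le> real (nat q ^ 3)"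
      using card_SL2_le by (simp only: of_nat_le_iff)
    then have SL2: "real (card SL2) \<le> Q ^ 3"
      using q_pos by (simp add: Q_def)
    have "e\<^sup>2 / real (card V) \<le> e\<^sup>2 / (Q\<^sup>2 / 2)"
      using card_V_ge card_V_pos Q by (intro divide_left_mono) (auto simp: Q_def)
    then have "(e\<^sup>2 / real (card V)) ^ n \<le> (e\<^sup>2 / (Q\<^sup>2 / 2)) ^ n"
      by (rule power_mono) simp
    also have "\<dots> = 2 ^ n * (e ^ (2 * n) / Q ^ (2 * n))"
      by (simp add: power_divide power_mult_distrib flip: power_mult)
    finally show "real (card SL2) * (e\<^sup>2 / real (card V)) ^ n \<le> Q ^ 3 * (2 ^ n * (e ^ (2 * n) / Q ^ (2 * n)))"
      using Q SL2 by (intro mult_mono) auto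
    \<comment> \<open>By \<open>dense\<close> the variance term (Q^3/p) e^n is dominated by the main
      term.\<close>
    have "e ^ n * Q ^ (2 * n) \<le> e ^ n * (real_of_int p * e ^ n)"
      using dense e by (intro mult_left_mono) (auto simp: n_def Q_def e_def)
    then have "e ^ n / real_of_int p \<le> e ^ (2 * n) / Q ^ (2 * n)"
      using Q p0 by (simp add: field_simps mult_2 mult_2_right power_add)
    then have "Q ^ 3 * (e ^ n / real_of_int p) \<le> Q ^ 3 * (e ^ (2 * n) / Q ^ (2 * n))"
      using Q by (intro mult_left_mono) auto
    then show "3 * energy_bound * e ^ n \<le> 3 * (Q ^ 3 * (e ^ (2 * n) / Q ^ (2 * n)))"
      by (simp add: energy)
  qed auto
  also have "\<dots> = A * (Q ^ 3 * (e ^ (2 * n) / Q ^ (2 * n)))"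
    by (simp add: A_def algebra_simps add_divide_distrib)
  finally have P: "real (card P) \<le> A * (Q ^ 3 * (e ^ (2 * n) / Q ^ (2 * n)))" .
  have "real (card E ^ n) \<le> real (2 * card G)"
    unfolding n_def G_def of_nat_le_iff by (rule card_unit_configs_ge[OF E k large])
  then have "e ^ n \<le> 2 * real (card G)" by (simp add: e_def)
  then have "e ^ n * e ^ n \<le> (2 * real (card G)) * (2 * real (card G))"
    using e by (intro mult_mono) auto
  also have "\<dots> \<le> 4 * (N * real (card P))" using cs by simp
  also have "\<dots> \<le> 4 * (N * (A * (Q ^ 3 * (e ^ (2 * n) / Q ^ (2 * n)))))"
    using P by (intro mult_left_mono) (auto simp: N_def)
  finally have "e ^ (2 * n) * 1 \<le> e ^ (2 * n) * (4 * A * N * (Q ^ 3 / Q ^ (2 * n)))"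
    by (simp add: mult_2 mult_2_right power_add mult_ac)
  then have "1 \<le> 4 * A * N * (Q ^ 3 / Q ^ (2 * n))"
    using e by (simp only: mult_le_cancel_left_pos zero_less_power)
  \<comment> \<open>The remaining exponent 2n - 3 is the 2k - 1 of the upper bound.\<close>
  also have "2 * n = (2 * k - 1) + 3" using k by (simp add: n_def)
  also have "Q ^ 3 / Q ^ (2 * k - 1 + 3) = 1 / Q ^ (2 * k - 1)"
    using Q by (simp add: power_add)
  finally have "Q ^ (2 * k - 1) \<le> 4 * A * N"
    using Q by (simp add: field_simps)
  then show ?thesis by (simp add: A_def N_def Q_def n_def mult_ac)
qed

end

section \<open>Comparison of the upper and lower bounds\<close>

theorem theorem2:
  fixes k :: nat
  assumes "k \<ge> 1"
  shows "\<exists>C1 > 0. \<exists>C2 > 0. \<forall>(p::nat) (l::nat) (E :: (int \<times> int) set).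
           prime p \<longrightarrow> odd p \<longrightarrow> l \<ge> 1 \<longrightarrow> E \<subseteq> ZmodSq (int p ^ l) \<longrightarrow>
           real (card E) \<ge> C1 * real l powr (2 / real (k + 1))
                             * real p powr (real l * (2 - 1 / (real l * real (k + 1)))) \<longrightarrow>
           real (card (Cconf (int p ^ l) E k))
             \<ge> C2 * real (card (Cconf (int p ^ l) (ZmodSq (int p ^ l)) k))"
proof -
  \<comment> \<open>All classes number at most T Q^(2k-1), those of \<open>E\<close> at least
    Q^(2k-1)/A; hence 1/(A T) serves as \<open>C2\<close>.\<close>
  define A :: real where "A = 4 * 2 ^ (k + 1) * (2 ^ (k + 1) + 3)"
  define T :: real where "T = 2 * (real k + 1)\<^sup>2"
  have A: "A > 0" by (simp add: A_def add_pos_pos)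
  have T: "T > 0" by (simp add: T_def add_nonneg_pos)
  have "1 / (A * T) * real (card (Cconf (int p ^ l) (ZmodSq (int p ^ l)) k))
          \<le> real (card (Cconf (int p ^ l) E k))"
    if p: "prime p" and l: "l \<ge> 1" and E: "E \<subseteq> ZmodSq (int p ^ l)"
      and large: "real (card E) \<ge> 4 * real l powr (2 / real (k + 1))
                    * real p powr (real l * (2 - 1 / (real l * real (k + 1))))"
    for p l :: nat and E :: "(int \<times> int) set"
  proof -
    interpret prime_power_plane "int p" l "int p ^ l" "int p ^ (l - 1)"
      by unfold_locales (use p l in auto)
    define n where "n = k + 1"
    define q where "q = int p ^ l"
    define r where "r = int p ^ (l - 1)"
    define Q where "Q = real p ^ l"
    define B where "B = real p powr (real l * (2 - 1 / (real l * real n)))"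
    have p2: "real p \<ge> 2" using p prime_ge_2_nat by force
    have n: "n \<ge> 1" "real n > 0" by (auto simp: n_def)
    have Q: "Q = real_of_int q" "Q > 0" using p2 by (auto simp: Q_def q_def)
    have r: "real_of_int r * real p = Q"
      using l p2 by (cases l) (auto simp: r_def Q_def)
    have r0: "r > 0" using p2 by (simp add: r_def)
    \<comment> \<open>The exponent is 2l - 1/n, so B^n = Q^(2n)/p, precisely the threshold in the
      density hypothesis of \<open>card_Cconf_ge\<close>.\<close>
    have exponent: "real l * (2 - 1 / (real l * real n)) = real (2 * l) - 1 / real n"
      using l n by (simp add: field_simps)
    have B: "B = Q\<^sup>2 / real p powr (1 / real n)"
      using p2 unfolding B_def exponent
      by (simp only: powr_diff powr_realpow Q_def flip: power_mult) (simp add: mult.commute)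
    have "B ^ n = (Q\<^sup>2) ^ n / (real p powr (1 / real n)) ^ n"
      by (simp add: B power_divide)
    also have "(real p powr (1 / real n)) ^ n = real p"
      using p2 n by (simp add: powr_powr flip: powr_realpow)
    finally have Bn: "B ^ n = Q ^ (2 * n) / real p"
      by (simp add: power_mult)
    \<comment> \<open>Therefore \<open>B\<close> is at least Q^2/p = Q r, which supplies the size
      hypothesis of \<open>card_Cconf_ge\<close>.\<close>
    have "real p powr (1 / real n) \<le> real p powr 1"
      using p2 n by (intro powr_mono) auto
    then have "Q\<^sup>2 / real p \<le> B"
      unfolding B using p2 by (intro divide_left_mono) auto
    moreover have "Q\<^sup>2 / real p = Q * (real_of_int r * real p) / real p"
      by (simp add: r power2_eq_square)
    ultimately have QrB: "Q * real_of_int r \<le> B"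
      using p2 by simp
    have rQ: "real_of_int r \<le> Q"
    proof -
      have "real_of_int r * 1 \<le> real_of_int r * real p"
        using p2 r0 by (intro mult_left_mono) auto
      then show ?thesis by (simp add: r)
    qed
    have "real l powr (2 / real n) \<ge> 1"
      using l n by (intro ge_one_powr_ge_zero) auto
    then have "4 * 1 * B \<le> 4 * real l powr (2 / real n) * B"
      by (intro mult_mono) (auto simp: B_def)
    then have EB: "4 * B \<le> real (card E)"
      using large by (simp add: B_def n_def)
    \<comment> \<open>Of at least 4 B points, at most r^2 <= Q r <= B are not primitive, so at least
      2 B remain; this is the choice of 4 for \<open>C1\<close>.\<close>
    define E' where "E' = E \<inter> V"
    have finE: "finite E" using E finite_ZmodSq finite_subset by blast
    have "card E \<le> card (E' \<union> {x \<in> ZmodSq (int p ^ l). \<not> primitive (int p) x})"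
      using E finE by (intro card_mono) (auto simp: E'_def V_def)
    also have "\<dots> \<le> card E' + card {x \<in> ZmodSq (int p ^ l). \<not> primitive (int p) x}"
      by (rule card_Un_le)
    also have "\<dots> \<le> card E' + nat r * nat r"
      using card_not_primitive_le by (simp add: r_def)
    finally have "real (card E) \<le> real (card E' + nat r * nat r)"
      by (simp only: of_nat_le_iff)
    then have "real (card E) \<le> real (card E') + real_of_int r * real_of_int r"
      using r0 by simp
    moreover have "real_of_int r * real_of_int r \<le> Q * real_of_int r"
      using rQ r0 by (intro mult_right_mono) auto
    ultimately have E'B: "2 * B \<le> real (card E')"
      using EB QrB by (auto simp: B_def intro: add_mono)
    have B0: "B \<ge> 0" by (simp add: B_def)
    have "real (2 * (nat q * nat r)) \<le> real (card E')"
      using E'B QrB r0 Q by (simp add: Q(1))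
    then have 1: "2 * (nat (int p ^ l) * nat (int p ^ (l - 1))) \<le> card E'"
      unfolding q_def r_def by (simp only: of_nat_le_iff)
    have "B ^ n \<le> real (card E') ^ n"
      using E'B B0 by (intro power_mono) auto
    then have 2: "real_of_int (int p ^ l) ^ (2 * (k + 1)) \<le> real_of_int (int p) * real (card E') ^ (k + 1)"
      using p2 unfolding Bn by (simp add: n_def Q_def field_simps)
    have "Q ^ (2 * k - 1) \<le> A * real (card (Cconf (int p ^ l) E' k))"
      using card_Cconf_ge[OF _ assms 1 2] by (simp add: A_def Q_def E'_def)
    also have "\<dots> \<le> A * real (card (Cconf (int p ^ l) E k))"
      using A card_Cconf_mono[OF finE, of E'] by (intro mult_left_mono) (auto simp: E'_def)
    finally have lower: "Q ^ (2 * k - 1) \<le> A * real (card (Cconf (int p ^ l) E k))" .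
    have "real (card (Cconf (int p ^ l) (ZmodSq (int p ^ l)) k))
        \<le> real (2 * (k + 1)\<^sup>2 * nat (int p ^ l) ^ (2 * k - 1))"
      unfolding of_nat_le_iff using p assms by (intro card_Cconf_le) auto
    also have "\<dots> = T * Q ^ (2 * k - 1)"
      by (simp add: T_def Q_def nat_power_eq)
    also have "\<dots> \<le> T * (A * real (card (Cconf (int p ^ l) E k)))"
      using lower T by (intro mult_left_mono) auto
    finally show ?thesis
      using A T by (simp add: field_simps)
  qed
  then show ?thesis
    using A T by (intro exI[of _ "4 :: real"] exI[of _ "1 / (A * T)"] conjI allI impI) auto
qed

end
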